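(* Let $L^+_{\mathrm{conj}}>0$ be such that $\tau_{\mathcal{F}_+}(L^+_{\mathrm{conj}})=\frac{KK_B}{C_B}e^{-C_BL^+_{\mathrm{conj}}}<1$, and set $$\epsilon_0=\frac{\tau_{\mathcal F_+}(L^+_{\mathrm{conj}})}{1-\tau_{\mathcal F_+}(L^+_{\mathrm{conj}})}\max_{j\in\{1,2\},\,\mathrm{s},\mathrm{u}}\|\check V_j^{\mathrm{s}/\mathrm{u}}\|.$$ With $M_1,M_2,\sigma_{\min},\tilde\beta,\tilde\gamma$ as in the context, define $$\epsilon_\beta=e^{-\mathrm{Re}(\mu_1^{\mathrm{u}})L^+_{\mathrm{conj}}}\|\tilde\beta\|,\qquad \epsilon_\gamma=e^{-\mathrm{Re}(\mu_1^{\mathrm{u}})L^+_{\mathrm{conj}}}\|\tilde\gamma\|^{-1},$$ $$C_{M_4}=\|M_2\|\left[\|(\check{\mathcal V}^{\mathrm{u}}_{1;4})^{-1}\|+\frac{\|(\check{\mathcal V}^{\mathrm{s}}_{1;4})^{-1}\|\,(1+\epsilon_0\|(\check{\mathcal V}^{\mathrm{u}}_{1;4})^{-1}\|)}{1-\epsilon_0\|(\check{\mathcal V}^{\mathrm{s}}_{1;4})^{-1}\|}\right],$$ $$C_{M_3}=2\left(\|\check{\mathcal V}^{\mathrm{s}}_{3;4}\|+\|\check{\mathcal V}^{\mathrm{s}}_{1;2}\|\right)+2\epsilon_0.$$ If $L^+_{\mathrm{conj}}$ is chosen so that $$\epsilon_0\|(\check{\mathcal V}^{\mathrm{s}}_{1;4})^{-1}\|<1$$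 and $$\sigma_{\min}>\epsilon_0C_{M_3}\|M_2\|+(\epsilon_0C_{M_3}+\|M_1\|)(\epsilon_0C_{M_4}+\epsilon_\beta\epsilon_\gamma),$$ then there cannot be any conjugate points for $x\ge L^+_{\mathrm{conj}}$; that is, $\mathbb{E}^{\mathrm{u}}_-(x)\cap\ell_{\mathrm{sand}}=\{0\}$ for all $x\ge L^+_{\mathrm{conj}}$.
   Context: Fix $\hat\mu,\hat\nu>0$ and $f(u)=\hat\nu u^2-u^3-\hat\mu u$. Let $\varphi:\mathbb{R}\to\mathbb{R}$ be a (nonzero) pulse: $0=-(1+\partial_x^2)^2\varphi+f(\varphi)$, $\lim_{|x|\to\infty}\varphi(x)=0$. Consider $Q'=B(x)Q$ with $$B(x)=\begin{pmatrix}0&0&0&1\\0&0&1&-2\\-1+f'(\varphi(x))&0&0&0\\0&1&0&0\end{pmatrix},\quad B_\infty=\lim_{|x|\to\infty}B(x),\quad \tilde B(x)=B(x)-B_\infty,$$ and let $K_B,C_B>0$ satisfy $\|B(x)-B_\infty\|\le K_Be^{-C_B|x|}$. $\mathbb{E}^{\mathrm{u}}_-(x)\subset\mathbb{R}^4$ (resp. $\mathbb{C}\mathbb{E}^{\mathrm{u}}_-(x)\subset\mathbb{C}^4$) is the set of values at $x$ of real (resp. complex) solutions tending to $0$ as $x\to-\infty$; $\mathbb{C}\mathbb{E}^{\mathrm{s}}_+(x)$ is the set of values at $x$ of complex solutions tending to $0$ as $x\to+\infty$. $\ell_{\mathrm{sand}}=\{(0,u_1,u_2,0)^T:u_1,u_2\in\mathbb{R}\}$.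 A conjugate point is an $x$ with $\mathbb{E}^{\mathrm{u}}_-(x)\cap\ell_{\mathrm{sand}}\ne\{0\}$. Let $\rho=\sqrt{1+\hat\mu}$, $\tan\theta=-\sqrt{\hat\mu}$, $\theta\in(\pi/2,\pi)$. The eigenvalues of $B_\infty$ are $\mu_1^{\mathrm{u}}=\sqrt\rho e^{i\theta/2}$, $\mu_2^{\mathrm{u}}=\sqrt\rho e^{-i\theta/2}$, $\mu_j^{\mathrm{s}}=-\mu_j^{\mathrm{u}}$, with eigenvectors $$\check V_1^{\mathrm{u}}=\big(\tfrac1\rho e^{-i\theta},1,c,\tfrac1{\sqrt\rho}e^{-i\theta/2}\big)^T,\quad \check V_1^{\mathrm{s}}=\big(\tfrac1\rho e^{-i\theta},1,-c,-\tfrac1{\sqrt\rho}e^{-i\theta/2}\big)^T,\quad c=\sqrt\rho e^{i\theta/2}+\tfrac2{\sqrt\rho}e^{-i\theta/2},$$ and $\check V_2^{\mathrm{s}/\mathrm{u}}=\overline{\check V_1^{\mathrm{s}/\mathrm{u}}}$. Put $\check{\mathcal V}^{\mathrm{s}/\mathrm{u}}=[\check V_1^{\mathrm{s}/\mathrm{u}}|\check V_2^{\mathrm{s}/\mathrm{u}}]\in\mathbb{C}^{4\times2}$, and let $\check{\mathcal V}$ be the $4\times4$ matrix whose columns are all four eigenvectors; $K=\|\check{\mathcal V}^{-1}\|\|\check{\mathcal V}\|$. For a matrix $\mathcal{M}$ with four rows, $\mathcal{M}_{i;j}$ is the submatrix consisting of rows $i$ and $j$. Solutions at $+\infty$: for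 each $\mu=\mu_j^{\mathrm{s}/\mathrm{u}}$ and $\check V=\check V_j^{\mathrm{s}/\mathrm{u}}$ let $\mathcal{P}^{-}$, $\mathcal{P}^{0+}$ be the spectral projections of $B_\infty-\mu I$ for eigenvalues with negative, resp. nonnegative, real part, and let $\mathcal{F}_+$ act on $X=L^\infty([L^+_{\mathrm{conj}},\infty),\mathbb{C}^4)$ by $$\mathcal{F}_+(W)(x)=\check V+\int_{L^+_{\mathrm{conj}}}^{x}e^{(B_\infty-\mu I)(x-y)}\mathcal{P}^{-}\tilde B(y)W(y)\,dy-\int_x^\infty e^{(B_\infty-\mu I)(x-y)}\mathcal{P}^{0+}\tilde B(y)W(y)\,dy.$$ When $\tau_{\mathcal F_+}(L^+_{\mathrm{conj}})<1$, $\mathcal{F}_+$ is a contraction with unique fixed point $W_j^{+,\mathrm{s}/\mathrm{u}}=\check V_j^{\mathrm{s}/\mathrm{u}}+\tilde W_j^{+,\mathrm{s}/\mathrm{u}}$, and the four functions $e^{\mu_j^{\mathrm{s}/\mathrm{u}}x}W_j^{+,\mathrm{s}/\mathrm{u}}(x)$ form a basis of solutions of $Q'=B(x)Q$, with $\tilde W_j^{+,\mathrm{s}/\mathrm{u}}(x)\to0$ as $x\to\infty$. Put $\tilde{\mathcal W}^{+,\mathrm{s}/\mathrm{u}}=[\tilde W_1^{+,\mathrm{s}/\mathrm{u}}|\tilde W_2^{+,\mathrm{s}/\mathrm{u}}]$. Standing assumption ($\lambda=0$ is a simple eigenvalue): $\mathbb{C}\mathbb{E}^{\mathrm{u}}_-(x)\cap\mathbb{C}\mathbb{E}^{\mathrm{s}}_+(x)=\mathrm{span}\{U_{\varphi'}(x)\}$,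 where $U_{\varphi'}=(\varphi',\varphi''',\varphi''''+2\varphi'',\varphi'')$. Let $U_1(x)$ be a solution with $\mathbb{C}\mathbb{E}^{\mathrm{u}}_-(x)=\mathrm{span}\{U_{\varphi'}(x),U_1(x)\}$. With $\Omega^{\mathrm{s}}=\mathrm{diag}(\mu_1^{\mathrm{s}},\mu_2^{\mathrm{s}})$ and $\Omega^{\mathrm{u}}=-\Omega^{\mathrm{s}}$, the constant vectors $\tilde\beta,\tilde\gamma\in\mathbb{C}^2$ are determined by $$U_1(x)=(\check{\mathcal V}^{\mathrm{s}}+\tilde{\mathcal W}^{+,\mathrm{s}}(x))e^{\Omega^{\mathrm{s}}x}\tilde\beta+(\check{\mathcal V}^{\mathrm{u}}+\tilde{\mathcal W}^{+,\mathrm{u}}(x))e^{\Omega^{\mathrm{u}}x}\tilde\gamma;$$ $\tilde\gamma\ne0$ since $U_1\notin\mathbb{C}\mathbb{E}^{\mathrm{s}}_+$. $M_1=(\check{\mathcal V}^{\mathrm{s}}_{3;4})^*\check{\mathcal V}^{\mathrm{u}}_{1;2}+(\check{\mathcal V}^{\mathrm{u}}_{1;2})^*\check{\mathcal V}^{\mathrm{s}}_{3;4}$, $M_2=(\check{\mathcal V}^{\mathrm{s}}_{1;4})^{-1}\check{\mathcal V}^{\mathrm{u}}_{1;4}$, and $\sigma_{\min}=\min\{\sqrt{|\mu|}:\mu\text{ an eigenvalue of }M_1^*M_2M_2^*M_1\}$. Here $^*$ is the conjugate transpose. Norms: Euclidean norm on vectors, induced operator norm on matrices. *)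

theory Defs
  imports "HOL-Analysis.Analysis"
begin

section \<open>Linear algebra\<close>

text \<open>
  Matrices are HOL-Analysis matrices; \<open>'a^'n^'m\<close> has \<open>'m\<close> rows and \<open>'n\<close> columns.
  The norm on \<open>'a^'n\<close> is the Euclidean norm. Matrix norms are \<^emph>\<open>not\<close> the norm of the type
  \<open>'a^'n^'m\<close> (which is the Frobenius norm) but the induced operator norm.
\<close>

definition opnorm :: "'a::real_normed_field^'n^'m \<Rightarrow> real" where
  "opnorm A = onorm ((*v) A)"

definition cmat :: "real^'n^'m \<Rightarrow> complex^'n^'m" where
  "cmat A = map_matrix complex_of_real A"

definition cvec :: "real^'n \<Rightarrow> complex^'n" where
  "cvec v = (\<chi> i. complex_of_real (v $ i))"

definition ctranspose :: "complex^'n^'m \<Rightarrow> complex^'m^'n" where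
  "ctranspose A = map_matrix cnj (transpose A)"

definition cols2 :: "'a::zero^'m \<Rightarrow> 'a^'m \<Rightarrow> 'a^2^'m" where
  "cols2 u v = transpose (vector [u, v])"

definition cols4 :: "'a::zero^'m \<Rightarrow> 'a^'m \<Rightarrow> 'a^'m \<Rightarrow> 'a^'m \<Rightarrow> 'a^4^'m" where
  "cols4 u v w z = transpose (vector [u, v, w, z])"

definition diag2 :: "'a::zero \<Rightarrow> 'a \<Rightarrow> 'a^2^2" where
  "diag2 a b = vector [vector [a, 0], vector [0, b]]"

definition rows2 :: "4 \<Rightarrow> 4 \<Rightarrow> 'a::zero^'n^4 \<Rightarrow> 'a^'n^2" where
  "rows2 i j M = vector [M $ i, M $ j]"

definition eigenvalues :: "complex^'n^'n \<Rightarrow> complex set" where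
  "eigenvalues A = {z. \<exists>v. v \<noteq> 0 \<and> A *v v = z *s v}"

text \<open>\<open>(*)\<close> and \<open>(^)\<close> on \<open>'a^'n^'n\<close> are componentwise, so powers are iterates of \<open>(**)\<close>.\<close>

definition mexp :: "complex^'n^'n \<Rightarrow> complex^'n^'n" where
  "mexp A = (\<Sum>k. (1 / fact k) *\<^sub>R ((((**) A) ^^ k) (mat 1)))"

definition gen_eigenspace :: "complex^'n^'n \<Rightarrow> complex \<Rightarrow> (complex^'n) set" where
  "gen_eigenspace A z = {v. \<exists>k. (((*v) (A - mat z)) ^^ k) v = 0}"

text \<open>
  The spectral projection of \<open>A\<close> for the eigenvalues lying in \<open>S\<close>: the projection onto the sum of
  the generalized eigenspaces for eigenvalues in \<open>S\<close> along the sum of the remaining ones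
  (\<open>gen_eigenspace A z = {0}\<close> if \<open>z\<close> is not an eigenvalue).
\<close>

definition spectral_proj :: "complex^'n^'n \<Rightarrow> complex set \<Rightarrow> complex^'n^'n" where
  "spectral_proj A S = (THE P. P ** P = P
     \<and> range ((*v) P) = vec.span (\<Union>z\<in>S. gen_eigenspace A z)
     \<and> {v. P *v v = 0} = vec.span (\<Union>z\<in>-S. gen_eigenspace A z))"


section \<open>Linear systems \<open>Q' = A(x) Q\<close> and conjugate points\<close>

definition is_solution :: "(real \<Rightarrow> 'a::real_normed_field^'n^'n) \<Rightarrow> (real \<Rightarrow> 'a^'n) \<Rightarrow> bool" where
  "is_solution A Q \<longleftrightarrow> (\<forall>x. (Q has_vector_derivative (A x *v Q x)) (at x))"

text \<open>For \<open>'a = real\<close> this is the real space at \<open>x\<close>, for \<open>'a = complex\<close> the complex one.\<close>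

definition Eu_minus :: "(real \<Rightarrow> 'a::real_normed_field^'n^'n) \<Rightarrow> real \<Rightarrow> ('a^'n) set" where
  "Eu_minus A x = {Q x | Q. is_solution A Q \<and> (Q \<longlongrightarrow> 0) at_bot}"

definition Es_plus :: "(real \<Rightarrow> 'a::real_normed_field^'n^'n) \<Rightarrow> real \<Rightarrow> ('a^'n) set" where
  "Es_plus A x = {Q x | Q. is_solution A Q \<and> (Q \<longlongrightarrow> 0) at_top}"

definition sandwich :: "(real^4) set" where
  "sandwich = {vector [0, u1, u2, 0] | u1 u2. True}"

definition conjugate_point :: "(real \<Rightarrow> real^4^4) \<Rightarrow> real \<Rightarrow> bool" where
  "conjugate_point A x \<longleftrightarrow> Eu_minus A x \<inter> sandwich \<noteq> {0}"


section \<open>The pulse and the linearised system\<close>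

text \<open>Throughout, \<open>m\<close> and \<open>n\<close> stand for the parameters \<open>\<mu>\<close>-hat and \<open>\<nu>\<close>-hat.\<close>

definition sh_f :: "real \<Rightarrow> real \<Rightarrow> real \<Rightarrow> real" where
  "sh_f m n u = n * u\<^sup>2 - u ^ 3 - m * u"

definition one_plus_dxx :: "(real \<Rightarrow> real) \<Rightarrow> real \<Rightarrow> real" where
  "one_plus_dxx u x = u x + deriv (deriv u) x"

definition pulse :: "real \<Rightarrow> real \<Rightarrow> (real \<Rightarrow> real) \<Rightarrow> bool" where
  "pulse m n \<phi> \<longleftrightarrow>
     (\<forall>k<4. \<forall>x. ((deriv ^^ k) \<phi>) differentiable (at x)) \<and>
     (\<forall>x. 0 = - one_plus_dxx (one_plus_dxx \<phi>) x + sh_f m n (\<phi> x)) \<and>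
     (\<phi> \<longlongrightarrow> 0) at_infinity \<and>
     (\<exists>x. \<phi> x \<noteq> 0)"

definition B :: "real \<Rightarrow> real \<Rightarrow> (real \<Rightarrow> real) \<Rightarrow> real \<Rightarrow> real^4^4" where
  "B m n \<phi> x = vector
     [vector [0, 0, 0, 1],
      vector [0, 0, 1, -2],
      vector [-1 + deriv (sh_f m n) (\<phi> x), 0, 0, 0],
      vector [0, 1, 0, 0]]"

definition B_inf :: "real \<Rightarrow> real \<Rightarrow> (real \<Rightarrow> real) \<Rightarrow> real^4^4" where
  "B_inf m n \<phi> = Lim at_infinity (B m n \<phi>)"

definition B_tilde :: "real \<Rightarrow> real \<Rightarrow> (real \<Rightarrow> real) \<Rightarrow> real \<Rightarrow> real^4^4" where
  "B_tilde m n \<phi> x = B m n \<phi> x - B_inf m n \<phi>"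

abbreviation cB :: "real \<Rightarrow> real \<Rightarrow> (real \<Rightarrow> real) \<Rightarrow> real \<Rightarrow> complex^4^4" where
  "cB m n \<phi> x \<equiv> cmat (B m n \<phi> x)"

definition U_phi' :: "(real \<Rightarrow> real) \<Rightarrow> real \<Rightarrow> real^4" where
  "U_phi' \<phi> x = vector
     [(deriv ^^ 1) \<phi> x, (deriv ^^ 3) \<phi> x,
      (deriv ^^ 4) \<phi> x + 2 * (deriv ^^ 2) \<phi> x, (deriv ^^ 2) \<phi> x]"


section \<open>Eigenvalues and eigenvectors at infinity\<close>

definition rho :: "real \<Rightarrow> real" where
  "rho m = sqrt (1 + m)"

definition theta :: "real \<Rightarrow> real" where
  "theta m = (THE t. pi / 2 < t \<and> t < pi \<and> tan t = - sqrt m)"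

definition mu1u :: "real \<Rightarrow> complex" where
  "mu1u m = complex_of_real (sqrt (rho m)) * cis (theta m / 2)"

definition mu2u :: "real \<Rightarrow> complex" where
  "mu2u m = complex_of_real (sqrt (rho m)) * cis (- (theta m / 2))"

definition mu1s :: "real \<Rightarrow> complex" where "mu1s m = - mu1u m"

definition mu2s :: "real \<Rightarrow> complex" where "mu2s m = - mu2u m"

definition c_ev :: "real \<Rightarrow> complex" where
  "c_ev m = complex_of_real (sqrt (rho m)) * cis (theta m / 2)
          + complex_of_real (2 / sqrt (rho m)) * cis (- (theta m / 2))"

definition V1u :: "real \<Rightarrow> complex^4" where
  "V1u m = vector
     [complex_of_real (1 / rho m) * cis (- theta m), 1, c_ev m,
      complex_of_real (1 / sqrt (rho m)) * cis (- (theta m / 2))]"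

definition V1s :: "real \<Rightarrow> complex^4" where
  "V1s m = vector
     [complex_of_real (1 / rho m) * cis (- theta m), 1, - c_ev m,
      - (complex_of_real (1 / sqrt (rho m)) * cis (- (theta m / 2)))]"

definition V2u :: "real \<Rightarrow> complex^4" where "V2u m = (\<chi> i. cnj (V1u m $ i))"

definition V2s :: "real \<Rightarrow> complex^4" where "V2s m = (\<chi> i. cnj (V1s m $ i))"

definition Vu :: "real \<Rightarrow> complex^2^4" where "Vu m = cols2 (V1u m) (V2u m)"

definition Vs :: "real \<Rightarrow> complex^2^4" where "Vs m = cols2 (V1s m) (V2s m)"

definition Vfull :: "real \<Rightarrow> complex^4^4" where
  "Vfull m = cols4 (V1s m) (V2s m) (V1u m) (V2u m)"

definition K_cond :: "real \<Rightarrow> real" where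
  "K_cond m = opnorm (matrix_inv (Vfull m)) * opnorm (Vfull m)"

definition Omega_s :: "real \<Rightarrow> complex^2^2" where "Omega_s m = diag2 (mu1s m) (mu2s m)"

definition Omega_u :: "real \<Rightarrow> complex^2^2" where "Omega_u m = - Omega_s m"


section \<open>Solutions near plus infinity\<close>

definition F_plus ::
  "complex^4^4 \<Rightarrow> (real \<Rightarrow> complex^4^4) \<Rightarrow> real \<Rightarrow> complex \<Rightarrow> complex^4
    \<Rightarrow> (real \<Rightarrow> complex^4) \<Rightarrow> real \<Rightarrow> complex^4" where
  "F_plus Binf Bt L \<mu> V W x =
     V + (LINT y:{L..x}|lborel. mexp ((x - y) *\<^sub>R (Binf - mat \<mu>)) *v
            (spectral_proj (Binf - mat \<mu>) {z. Re z < 0} *v (Bt y *v W y)))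
       - (LINT y:{x..}|lborel. mexp ((x - y) *\<^sub>R (Binf - mat \<mu>)) *v
            (spectral_proj (Binf - mat \<mu>) {z. Re z \<ge> 0} *v (Bt y *v W y)))"

text \<open>
  A fixed point of \<open>F_plus\<close> in \<open>L\<^sup>\<infinity>([L,\<infinity>))\<close>. As \<open>F_plus\<close> sends an almost-everywhere class to a
  pointwise defined (continuous) function, the class has a unique representative that satisfies the
  fixed point equation at every \<open>x \<ge> L\<close>; \<open>W\<close> is that representative. Its values below \<open>L\<close> are
  irrelevant.
\<close>

definition F_plus_fixed ::
  "real \<Rightarrow> real \<Rightarrow> (real \<Rightarrow> real) \<Rightarrow> real \<Rightarrow> complex \<Rightarrow> complex^4 \<Rightarrow> (real \<Rightarrow> complex^4) \<Rightarrow> bool" where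
  "F_plus_fixed m n \<phi> L \<mu> V W \<longleftrightarrow>
     set_borel_measurable lborel {L..} W \<and>
     (\<exists>C. AE x\<in>{L..} in lborel. norm (W x) \<le> C) \<and>
     (\<forall>x\<ge>L. W x = F_plus (cmat (B_inf m n \<phi>)) (\<lambda>y. cmat (B_tilde m n \<phi> y)) L \<mu> V W x)"


section \<open>Constants\<close>

definition M1 :: "real \<Rightarrow> complex^2^2" where
  "M1 m = ctranspose (rows2 3 4 (Vs m)) ** rows2 1 2 (Vu m)
        + ctranspose (rows2 1 2 (Vu m)) ** rows2 3 4 (Vs m)"

definition M2 :: "real \<Rightarrow> complex^2^2" where
  "M2 m = matrix_inv (rows2 1 4 (Vs m)) ** rows2 1 4 (Vu m)"

definition sigma_min :: "real \<Rightarrow> real" where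
  "sigma_min m = Min {sqrt (cmod z) | z.
     z \<in> eigenvalues (ctranspose (M1 m) ** M2 m ** ctranspose (M2 m) ** M1 m)}"

definition tau_F :: "real \<Rightarrow> real \<Rightarrow> real \<Rightarrow> real \<Rightarrow> real" where
  "tau_F m K_B C_B L = K_cond m * K_B / C_B * exp (- C_B * L)"

definition eps0 :: "real \<Rightarrow> real \<Rightarrow> real \<Rightarrow> real \<Rightarrow> real" where
  "eps0 m K_B C_B L = tau_F m K_B C_B L / (1 - tau_F m K_B C_B L)
     * Max {norm (V1s m), norm (V2s m), norm (V1u m), norm (V2u m)}"

definition eps_beta :: "real \<Rightarrow> real \<Rightarrow> complex^2 \<Rightarrow> real" where
  "eps_beta m L \<beta> = exp (- Re (mu1u m) * L) * norm \<beta>"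

definition eps_gamma :: "real \<Rightarrow> real \<Rightarrow> complex^2 \<Rightarrow> real" where
  "eps_gamma m L \<gamma> = exp (- Re (mu1u m) * L) * inverse (norm \<gamma>)"

definition C_M4 :: "real \<Rightarrow> real \<Rightarrow> real" where
  "C_M4 m e = opnorm (M2 m) *
     (opnorm (matrix_inv (rows2 1 4 (Vu m)))
      + opnorm (matrix_inv (rows2 1 4 (Vs m))) * (1 + e * opnorm (matrix_inv (rows2 1 4 (Vu m))))
        / (1 - e * opnorm (matrix_inv (rows2 1 4 (Vs m)))))"

definition C_M3 :: "real \<Rightarrow> real \<Rightarrow> real" where
  "C_M3 m e = 2 * (opnorm (rows2 3 4 (Vs m)) + opnorm (rows2 1 2 (Vs m))) + 2 * e"

end

(*
  Let x be at least L and let v be a real vector of E^u_-(x) on the sandwich plane.  The columns of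
  the frames S = V^s + W~^s and T = V^u + W~^u at x come from solutions, S from decaying ones.

  The system is Hamiltonian, so the symplectic form omega is constant along pairs of solutions and
  vanishes on pairs that decay at the same end.  Hence the range of S is Lagrangian, and since the
  rows 1;4 of S are invertible, U_phi'(x), being omega-orthogonal to it, has the form S xi.  As
  omega(U_phi', U_1) = 0, this gives omega(S xi, T zeta) = 0 where U_1(x) = S eta + T zeta.  In the
  limit frame omega(V^s z, V^u y) = -z^T P M_1 y with P the swap of the two coordinates, and the error
  is controlled by eps_0 C_M3.

  If v = a S xi + b (S eta + T zeta) has vanishing components 1 and 4, then
  a xi + b eta = -(M_2 + O(eps_0 C_M4)) b zeta, and pairing with T zeta makes the quadratic form of
  M_2^* M_1 at b zeta smaller than sigma_min |b zeta|^2.  Since v is real, b zeta is invariant under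
  conjugation composed with P, and for such vectors the form is bounded below by sigma_min because
  M_2^* M_1 is Hermitian and positive.  So b zeta = 0, and then v = 0.
*)

theory Submission
  imports Defs
begin

section \<open>Matrices and the operator norm\<close>

text \<open>Every quadratic form on C^2 has a nonzero isotropic vector, so the lower bound by
  sigma_min cannot hold on all of C^2; this is why the reality of v must be passed on to b zeta.
  That step would be immediate if the four columns of S and T were independent at x, but nothing
  guarantees this beforehand. The sigma_min inequality supplies what is needed: if T Delta lies in
  the range of S, then omega(S z, T Delta) = 0 for every z because that range is isotropic, and
  testing with z = M_2 Delta forces Delta = 0. So the inequality is used twice, first for reality
  and then for b zeta itself. Conjugation symmetry of the frames comes from uniqueness of the fixed
  points: the conjugate of one fixed point solves the equation for the conjugate eigenvalue. The
  product eps_beta eps_gamma bounds |eta| / |zeta|: these norms are |beta| and |gamma| times e^(-x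
  Re mu) and e^(x Re mu), so for x >= L the ratio is at most e^(-2 L Re mu) |beta| / |gamma|. C_M3
  collects the first and second order errors of omega, C_M4 those of the quotient M_2.\<close>

lemma vector_4 [simp]:
  "(vector [a, b, c, d] :: 'a::zero^4) $ 1 = a"
  "(vector [a, b, c, d] :: 'a::zero^4) $ 2 = b"
  "(vector [a, b, c, d] :: 'a::zero^4) $ 3 = c"
  "(vector [a, b, c, d] :: 'a::zero^4) $ 4 = d"
  unfolding vector_def by simp_all

lemma norm_matrix_vector_le:
  fixes A :: "'a::{euclidean_space,real_normed_field}^'n^'m"
  shows "norm (A *v x) \<le> opnorm A * norm x"
  unfolding opnorm_def by (rule onorm) simp

lemma opnorm_nonneg: "0 \<le> opnorm (A :: 'a::{euclidean_space,real_normed_field}^'n^'m)"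
  unfolding opnorm_def by (rule onorm_pos_le) simp

lemma opnorm_uminus: "opnorm (- A) = opnorm (A :: 'a::{euclidean_space,real_normed_field}^'n^'m)"
proof -
  have "(- A) *v x = - (A *v x)" for x
    by (simp add: vec_eq_iff matrix_vector_mult_def sum_negf)
  then have "(*v) (- A) = (\<lambda>x. - (A *v x))"
    by auto
  then show ?thesis
    by (simp add: opnorm_def onorm_neg)
qed

lemma matrix_inv_mult:
  fixes A :: "'a::field^'n^'n"
  assumes "invertible A"
  shows "A ** matrix_inv A = mat 1" "matrix_inv A ** A = mat 1"
  using someI_ex [OF assms [unfolded invertible_def]] by (auto simp: matrix_inv_def)

lemma inverse_mult_vec:
  fixes A :: "'a::field^'n^'n"
  assumes "invertible A"
  shows "matrix_inv A *v (A *v x) = x" "A *v (matrix_inv A *v x) = x"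
  using assms by (simp_all add: matrix_vector_mul_assoc matrix_inv_mult)

lemma invertible_iff_ker:
  fixes A :: "'a::field^'n^'n"
  shows "invertible A \<longleftrightarrow> (\<forall>x. A *v x = 0 \<longrightarrow> x = 0)"
  by (simp add: invertible_left_inverse matrix_left_invertible_ker)

lemma norm_le_componentwise:
  fixes x y :: "'a::real_normed_vector^'n"
  assumes "\<And>i. norm (x $ i) \<le> norm (y $ i)"
  shows "norm x \<le> norm y"
  unfolding norm_vec_def by (rule L2_set_mono) (use assms in auto)

lemma norm_sq_2: "(norm (x :: 'a::real_normed_vector^2))\<^sup>2 = (norm (x $ 1))\<^sup>2 + (norm (x $ 2))\<^sup>2"
  by (simp add: norm_vec_def L2_set_def sum_2)

lemma norm_sq_4:
  "(norm (x :: 'a::real_normed_vector^4))\<^sup>2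
    = (norm (x $ 1))\<^sup>2 + (norm (x $ 2))\<^sup>2 + (norm (x $ 3))\<^sup>2 + (norm (x $ 4))\<^sup>2"
  by (simp add: norm_vec_def L2_set_def sum_4 add_nonneg_nonneg)

lemma cols2_mult: "cols2 u v *v x = x $ 1 *s u + x $ 2 *s (v :: 'a::comm_ring_1^'m)"
  by (simp add: vec_eq_iff cols2_def matrix_vector_mult_def transpose_def sum_2 mult.commute)

lemma cols4_mult:
  "cols4 u v w z *v x = x $ 1 *s u + x $ 2 *s v + x $ 3 *s w + x $ 4 *s (z :: 'a::comm_ring_1^'m)"
  by (simp add: vec_eq_iff cols4_def matrix_vector_mult_def transpose_def sum_4 mult.commute)

lemma rows2_mult: "rows2 i j M *v x = vector [(M *v x) $ i, (M *v x) $ j]"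
  for M :: "'a::comm_ring_1^'n^4"
  by (simp add: vec_eq_iff forall_2 rows2_def matrix_vector_mult_def)

lemma norm_smult_vec: "norm (c *s (w :: complex^'m)) = norm c * norm w"
  by (simp add: norm_vec_def L2_set_def norm_mult power_mult_distrib sum_distrib_left [symmetric] real_sqrt_mult)

text \<open>The factor \<open>sqrt 2\<close> is Cauchy-Schwarz for the two coefficients. It is
  absorbed into \<open>eps0\<close> by \<open>sqrt2_column_le_eps0\<close>.\<close>

lemma norm_cols2_le:
  fixes u v :: "complex^'m"
  assumes "norm u \<le> b" "norm v \<le> b"
  shows "norm (cols2 u v *v x) \<le> sqrt 2 * b * norm x"
proof -
  have "norm (cols2 u v *v x) \<le> norm (x $ 1) * b + norm (x $ 2) * b"
    unfolding cols2_mult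
    by (rule order.trans [OF norm_triangle_ineq])
      (intro add_mono; simp add: norm_smult_vec mult_left_mono assms)
  also have "\<dots> = (norm (x $ 1) + norm (x $ 2)) * b"
    by (simp add: algebra_simps)
  also have "\<dots> \<le> (sqrt 2 * norm x) * b"
  proof (rule mult_right_mono)
    have "(norm (x $ 1) + norm (x $ 2))\<^sup>2 \<le> 2 * (norm x)\<^sup>2"
      using sum_squares_bound [of "norm (x $ 1)" "norm (x $ 2)"]
      by (simp add: norm_sq_2 power2_sum)
    then have "(norm (x $ 1) + norm (x $ 2))\<^sup>2 \<le> (sqrt 2 * norm x)\<^sup>2"
      by (simp add: power_mult_distrib)
    then show "norm (x $ 1) + norm (x $ 2) \<le> sqrt 2 * norm x"
      by (rule power2_le_imp_le) simp
    show "0 \<le> b"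
      using assms(1) norm_ge_zero order.trans by blast
  qed
  finally show ?thesis
    by (simp add: algebra_simps)
qed

section \<open>Diagonalizable matrices\<close>

text \<open>For a diagonalizable matrix \<open>V ** dg d ** G\<close>, powers, exponential and
  spectral projections are again of this shape, with a function applied to \<open>d\<close>. Matrix
  functions thereby reduce to scalar ones.\<close>

definition dg :: "('n \<Rightarrow> 'a::zero) \<Rightarrow> 'a^'n^'n" where
  "dg d = (\<chi> i j. if i = j then d i else 0)"

lemma dg_mult_vec [simp]: "(dg d *v z) $ i = d i * (z :: 'a::comm_ring_1^'n) $ i"
  by (simp add: dg_def matrix_vector_mult_def if_distrib [where f = "\<lambda>x. x * _"] cong: if_cong)

lemma mat_mult_vec: "mat z *v x = z *s (x :: 'a::comm_ring_1^'n)"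
  by (simp add: vec_eq_iff mat_def matrix_vector_mult_def if_distrib [where f = "\<lambda>x. x * _"] cong: if_cong)

lemma matrix_vec_eqI: "(\<And>x. A *v x = A' *v x) \<Longrightarrow> A = (A' :: 'a::comm_ring_1^'n^'m)"
  by (rule matrix_eq [THEN iffD2]) simp

lemma dg_mult: "dg a ** dg b = dg (\<lambda>i. a i * b i :: 'a::comm_ring_1)"
  by (rule matrix_vec_eqI) (simp add: vec_eq_iff flip: matrix_vector_mul_assoc)

lemma dg_one: "dg (\<lambda>_. 1) = (mat 1 :: 'a::comm_ring_1^'n^'n)"
  by (simp add: dg_def mat_def)

lemma conj_dg_mult:
  fixes V G :: "'a::comm_ring_1^'n^'n"
  assumes "G ** V = mat 1"
  shows "(V ** dg a ** G) ** (V ** dg b ** G) = V ** dg (\<lambda>i. a i * b i) ** G"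
proof -
  have "(V ** dg a ** G) ** (V ** dg b ** G) = V ** dg a ** (G ** V) ** dg b ** G"
    by (simp only: matrix_mul_assoc)
  also have "\<dots> = V ** (dg a ** dg b) ** G"
    unfolding assms matrix_mul_rid by (simp only: matrix_mul_assoc)
  finally show ?thesis
    by (simp add: dg_mult)
qed

lemma conj_dg_power:
  fixes V G :: "'a::comm_ring_1^'n^'n"
  assumes "V ** G = mat 1" "G ** V = mat 1"
  shows "(((**) (V ** dg d ** G)) ^^ k) (mat 1) = V ** dg (\<lambda>i. d i ^ k) ** G"
  by (induction k) (simp_all add: dg_one assms conj_dg_mult)

lemma conj_dg_entry: "(V ** dg d ** G) $ i $ l = (\<Sum>j\<in>UNIV. V $ i $ j * d j * G $ j $ l)"
  for V G :: "'a::comm_ring_1^'n^'n"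
  by (simp add: matrix_matrix_mult_def dg_def if_distrib cong: if_cong)

text \<open>Each entry of the partial sums is a finite combination of scalar exponential series, so
  convergence can be checked entry by entry.\<close>

lemma mexp_conj_dg:
  fixes V G :: "complex^'n^'n"
  assumes "V ** G = mat 1" "G ** V = mat 1"
  shows "mexp (V ** dg d ** G) = V ** dg (\<lambda>i. exp (d i)) ** G"
proof -
  have "(\<lambda>k. (1 / fact k) *\<^sub>R (((**) (V ** dg d ** G)) ^^ k) (mat 1)) sums (V ** dg (\<lambda>i. exp (d i)) ** G)"
    unfolding sums_def
  proof (intro vec_tendstoI)
    fix i l
    have "(\<lambda>k. \<Sum>j\<in>UNIV. V $ i $ j * (d j ^ k /\<^sub>R fact k) * G $ j $ l)
        sums (\<Sum>j\<in>UNIV. V $ i $ j * exp (d j) * G $ j $ l)"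
      by (intro sums_sum sums_mult sums_mult2 exp_converges)
    then show "((\<lambda>n. (\<Sum>k<n. (1 / fact k) *\<^sub>R (((**) (V ** dg d ** G)) ^^ k) (mat 1)) $ i $ l)
        \<longlonglongrightarrow> (V ** dg (\<lambda>i. exp (d i)) ** G) $ i $ l)"
      unfolding sums_def conj_dg_power [OF assms] sum_component conj_dg_entry vector_scaleR_component
      by (simp add: scaleR_sum_right inverse_eq_divide conj_dg_entry)
  qed
  then show ?thesis
    unfolding mexp_def by (rule sums_unique [symmetric])
qed

lemma conj_dg_diff:
  fixes V G :: "'a::field^'n^'n"
  assumes "V ** G = mat 1"
  shows "V ** dg d ** G - mat z = V ** dg (\<lambda>i. d i - z) ** G"
proof (rule matrix_vec_eqI)
  fix x :: "'a^'n"
  have "V *v (G *v x) = x" for x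
    by (simp add: matrix_vector_mul_assoc assms)
  moreover have "dg (\<lambda>i. d i - z) *v w = dg d *v w - z *s w" for w
    by (simp add: vec_eq_iff algebra_simps)
  ultimately show "(V ** dg d ** G - mat z) *v x = (V ** dg (\<lambda>i. d i - z) ** G) *v x"
    by (simp add: matrix_vector_mult_diff_rdistrib matrix_vector_mult_diff_distrib vector_scalar_commute
        mat_mult_vec flip: matrix_vector_mul_assoc)
qed

text \<open>In the coordinates \<open>G *v v\<close> the k-th iterate multiplies entry
  \<open>i\<close> by \<open>(d i - z) ^ k\<close>. There is no nilpotent part, so
  \<open>k = 1\<close> already reaches the whole generalized eigenspace.\<close>

lemma gen_eigenspace_conj_dg:
  fixes V G :: "complex^'n^'n"
  assumes "V ** G = mat 1" "G ** V = mat 1"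
  shows "gen_eigenspace (V ** dg d ** G) z = {v. \<forall>i. d i \<noteq> z \<longrightarrow> (G *v v) $ i = 0}"
proof -
  have GV: "G *v (V *v x) = x" "V *v (G *v x) = x" for x
    by (simp_all add: matrix_vector_mul_assoc assms)
  have pow: "(((*v) (V ** dg d ** G - mat z)) ^^ k) v = V *v (dg (\<lambda>i. (d i - z) ^ k) *v (G *v v))" for k v
  proof (induction k)
    case 0
    then show ?case
      by (simp add: dg_one GV)
  next
    case (Suc k)
    have step: "dg (\<lambda>i. d i - z) *v (dg (\<lambda>i. (d i - z) ^ k) *v w) = dg (\<lambda>i. (d i - z) ^ Suc k) *v w" for w
      by (simp add: vec_eq_iff)
    have "(((*v) (V ** dg d ** G - mat z)) ^^ Suc k) v
        = (V ** dg d ** G - mat z) *v (V *v (dg (\<lambda>i. (d i - z) ^ k) *v (G *v v)))"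
      by (simp add: Suc)
    also have "\<dots> = V *v (dg (\<lambda>i. d i - z) *v (G *v (V *v (dg (\<lambda>i. (d i - z) ^ k) *v (G *v v)))))"
      by (simp add: conj_dg_diff [OF assms(1)] flip: matrix_vector_mul_assoc)
    also have "\<dots> = V *v (dg (\<lambda>i. (d i - z) ^ Suc k) *v (G *v v))"
      by (simp only: GV step)
    finally show ?case .
  qed
  have inj: "V *v w = 0 \<longleftrightarrow> w = 0" for w
    by (metis GV(1) matrix_vector_mult_0_right)
  have "(\<exists>k. dg (\<lambda>i. (d i - z) ^ k) *v w = 0) \<longleftrightarrow> (\<forall>i. d i \<noteq> z \<longrightarrow> w $ i = 0)" for w
  proof
    assume "\<forall>i. d i \<noteq> z \<longrightarrow> w $ i = 0"
    then have "dg (\<lambda>i. (d i - z) ^ 1) *v w = 0"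
      by (auto simp: vec_eq_iff)
    then show "\<exists>k. dg (\<lambda>i. (d i - z) ^ k) *v w = 0"
      by blast
  qed (auto simp: vec_eq_iff)
  then show ?thesis
    unfolding gen_eigenspace_def pow inj by simp
qed

text \<open>\<open>P'\<close> fixes \<open>P *v v\<close> by equality of ranges and kills
  \<open>v - P *v v\<close> by equality of kernels. This provides the uniqueness behind the
  \<open>THE\<close> in \<open>spectral_proj\<close>.\<close>

lemma projection_unique:
  fixes P P' :: "'a::comm_ring_1^'n^'n"
  assumes "P ** P = P" "P' ** P' = P'"
    and "range ((*v) P) = range ((*v) P')" "{v. P *v v = 0} = {v. P' *v v = 0}"
  shows "P = P'"
proof (rule matrix_vec_eqI)
  fix v
  have "P *v v \<in> range ((*v) P')"
    using assms(3) by blast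
  then have 1: "P' *v (P *v v) = P *v v"
    using assms(2) by (metis imageE matrix_vector_mul_assoc)
  have "P *v (v - P *v v) = 0"
    using assms(1) by (simp add: matrix_vector_mult_diff_distrib matrix_vector_mul_assoc)
  then have "P' *v (v - P *v v) = 0"
    using assms(4) by blast
  with 1 show "P *v v = P' *v v"
    by (simp add: matrix_vector_mult_diff_distrib)
qed

lemma range_conj_dg_indicator:
  fixes d :: "'n::finite \<Rightarrow> complex" and V G :: "complex^'n^'n"
  assumes "V ** G = mat 1" "G ** V = mat 1"
  shows "range ((*v) (V ** dg (\<lambda>i. if d i \<in> S then 1 else 0) ** G))
    = vec.span (\<Union>z\<in>S. gen_eigenspace (V ** dg d ** G) z)"
    (is "range ((*v) ?P) = vec.span ?X")
proof -
  have GV: "G *v (V *v x) = x" "V *v (G *v x) = x" for x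
    by (simp_all add: matrix_vector_mul_assoc assms)
  have P: "?P *v v = V *v (dg (\<lambda>i. if d i \<in> S then 1 else 0) *v (G *v v))" for v
    by (simp flip: matrix_vector_mul_assoc)
  show ?thesis
  proof
    show "range ((*v) ?P) \<subseteq> vec.span ?X"
    proof clarify
      fix v
      have "dg (\<lambda>i. if d i \<in> S then 1 else 0) *v (G *v v) = (\<chi> i. if d i \<in> S then (G *v v) $ i else 0)"
        by (simp add: vec_eq_iff)
      then have "?P *v v = (\<Sum>i\<in>UNIV. (if d i \<in> S then (G *v v) $ i else 0) *s column i V)"
        unfolding P by (simp only: matrix_mult_sum [of V] vec_lambda_beta)
      also have "\<dots> \<in> vec.span ?X"
      proof (intro vec.span_sum)
        fix i
        have "column i V \<in> ?X" if "d i \<in> S"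
        proof -
          have "G *v column i V = axis i 1"
            using arg_cong [OF assms(2), of "\<lambda>M. column i M"]
            by (simp add: vec_eq_iff column_def matrix_matrix_mult_def matrix_vector_mult_def mat_def axis_def)
          then have "column i V \<in> gen_eigenspace (V ** dg d ** G) (d i)"
            by (auto simp: gen_eigenspace_conj_dg [OF assms] axis_def)
          then show ?thesis
            using that by blast
        qed
        then show "(if d i \<in> S then (G *v v) $ i else 0) *s column i V \<in> vec.span ?X"
          by (simp add: vec.span_scale vec.span_base vec.span_zero)
      qed
      finally show "?P *v v \<in> vec.span ?X" .
    qed
    \<comment> \<open>For the other inclusion, the fixed vectors of \<open>?P\<close> form a
      subspace containing every generalized eigenspace with eigenvalue in \<open>S\<close>.\<close>
    have "?X \<subseteq> {v. ?P *v v = v}"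
    proof clarify
      fix z v assume z: "z \<in> S" "v \<in> gen_eigenspace (V ** dg d ** G) z"
      then have "dg (\<lambda>i. if d i \<in> S then 1 else 0) *v (G *v v) = G *v v"
        by (auto simp: gen_eigenspace_conj_dg [OF assms] vec_eq_iff)
      then show "?P *v v = v"
        by (simp add: P GV)
    qed
    moreover have "vec.subspace {v. ?P *v v = v}"
      unfolding vec.subspace_def by (simp only: mem_Collect_eq matrix_vector_right_distrib vector_scalar_commute) simp
    ultimately have "vec.span ?X \<subseteq> {v. ?P *v v = v}"
      by (rule vec.span_minimal)
    also have "{v. ?P *v v = v} \<subseteq> range ((*v) ?P)"
      by (auto intro: range_eqI [OF sym])
    finally show "vec.span ?X \<subseteq> range ((*v) ?P)" .
  qed
qed

text \<open>The projections for \<open>S\<close> and \<open>- S\<close> add up to the identity, so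
  the kernel of one is the range of the other. One computation of ranges then settles both
  conditions.\<close>

lemma spectral_proj_conj_dg:
  fixes V G :: "complex^'n^'n"
  assumes "V ** G = mat 1" "G ** V = mat 1"
  shows "spectral_proj (V ** dg d ** G) S = V ** dg (\<lambda>i. if d i \<in> S then 1 else 0) ** G"
    (is "_ = ?P S")
proof -
  have GV: "G *v (V *v x) = x" "V *v (G *v x) = x" for x
    by (simp_all add: matrix_vector_mul_assoc assms)
  have idem: "?P S ** ?P S = ?P S" for S
    by (simp add: conj_dg_mult [OF assms(2)] if_distrib cong: if_cong)
  have ran: "range ((*v) (?P S)) = vec.span (\<Union>z\<in>S. gen_eigenspace (V ** dg d ** G) z)" for S
    by (rule range_conj_dg_indicator [OF assms])
  have compl: "?P S *v v = 0 \<longleftrightarrow> ?P (- S) *v v = v" for v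
  proof -
    have "?P S *v v + ?P (- S) *v v = V *v (dg (\<lambda>i. if d i \<in> S then 1 else 0) *v (G *v v)
        + dg (\<lambda>i. if d i \<in> - S then 1 else 0) *v (G *v v))"
      by (simp add: matrix_vector_right_distrib flip: matrix_vector_mul_assoc)
    also have "dg (\<lambda>i. if d i \<in> S then 1 else 0) *v (G *v v)
        + dg (\<lambda>i. if d i \<in> - S then 1 else 0) *v (G *v v) = G *v v"
      by (auto simp: vec_eq_iff)
    finally have "?P S *v v + ?P (- S) *v v = v"
      by (simp add: GV)
    then show ?thesis
      by (metis add_cancel_right_left)
  qed
  have "{v. ?P S *v v = 0} = range ((*v) (?P (- S)))"
    unfolding compl
  proof (intro equalityI subsetI)
    fix v assume "v \<in> range ((*v) (?P (- S)))"
    then obtain w where "v = ?P (- S) *v w"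
      by blast
    then show "v \<in> {v. ?P (- S) *v v = v}"
      by (simp only: mem_Collect_eq matrix_vector_mul_assoc idem)
  next
    fix v assume "v \<in> {v. ?P (- S) *v v = v}"
    then show "v \<in> range ((*v) (?P (- S)))"
      by (intro range_eqI [OF sym]) (elim CollectE)
  qed
  then have ker: "{v. ?P S *v v = 0} = vec.span (\<Union>z\<in>- S. gen_eigenspace (V ** dg d ** G) z)"
    unfolding ran .
  show ?thesis
    unfolding spectral_proj_def
  proof (rule the_equality)
    show "?P S ** ?P S = ?P S \<and> range ((*v) (?P S)) = vec.span (\<Union>z\<in>S. gen_eigenspace (V ** dg d ** G) z)
      \<and> {v. ?P S *v v = 0} = vec.span (\<Union>z\<in>- S. gen_eigenspace (V ** dg d ** G) z)"
      by (rule conjI [OF idem conjI [OF ran ker]])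
  next
    fix P
    assume P: "P ** P = P \<and> range ((*v) P) = vec.span (\<Union>z\<in>S. gen_eigenspace (V ** dg d ** G) z)
      \<and> {v. P *v v = 0} = vec.span (\<Union>z\<in>- S. gen_eigenspace (V ** dg d ** G) z)"
    show "P = ?P S"
    proof (rule projection_unique)
      show "P ** P = P"
        using P by (elim conjE)
      show "range ((*v) P) = range ((*v) (?P S))"
        unfolding ran using P by (elim conjE)
      show "{v. P *v v = 0} = {v. ?P S *v v = 0}"
        unfolding ker using P by (elim conjE)
    qed (rule idem)
  qed
qed

section \<open>Exponential dichotomies and variation of constants\<close>

lemma exp_decay_integral:
  fixes C x :: real
  assumes "0 < C"
  shows "set_integrable lborel {x..} (\<lambda>y. exp (- C * y))"
    and "(LINT y:{x..}|lborel. exp (- C * y)) = exp (- C * x) / C"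
proof -
  have "has_bochner_integral lborel (\<lambda>y. exp (- C * y) * indicator {x..} y) (0 - (- exp (- C * x) / C))"
  proof (rule has_bochner_integral_nn_integral)
    have "filterlim (\<lambda>y. - C * y) at_bot at_top"
      by (rule filterlim_tendsto_neg_mult_at_bot [OF tendsto_const _ filterlim_ident]) (use assms in simp)
    then have "((\<lambda>y. - exp (- C * y) / C) \<longlongrightarrow> - 0 / C) at_top"
      using assms by (intro tendsto_intros filterlim_compose [OF exp_at_bot]) auto
    then have "(\<integral>\<^sup>+y. ennreal (exp (- C * y)) * indicator {x..} y \<partial>lborel) = ennreal (0 - (- exp (- C * x) / C))"
      by (intro nn_integral_FTC_atLeast) (use assms in \<open>auto intro!: derivative_eq_intros\<close>)
    then show "(\<integral>\<^sup>+y. ennreal (exp (- C * y) * indicator {x..} y) \<partial>lborel) = ennreal (0 - (- exp (- C * x) / C))"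
      by (simp add: ennreal_mult' ennreal_indicator)
  qed (use assms in auto)
  then show "set_integrable lborel {x..} (\<lambda>y. exp (- C * y))"
    "(LINT y:{x..}|lborel. exp (- C * y)) = exp (- C * x) / C"
    by (simp_all add: has_bochner_integral_iff set_integrable_def set_lebesgue_integral_def mult.commute)
qed

text \<open>The class of forcing terms \<open>Bt y *v W y\<close>. The bound is only almost
  everywhere because a fixed point is at first known only to be essentially bounded.\<close>

definition exp_decaying :: "real \<Rightarrow> real \<Rightarrow> real \<Rightarrow> (real \<Rightarrow> 'a::euclidean_space) \<Rightarrow> bool" where
  "exp_decaying L C c g \<longleftrightarrow> set_borel_measurable lborel {L..} g \<and>
     (AE y in lborel. L \<le> y \<longrightarrow> norm (g y) \<le> c * exp (- C * y))"

text \<open>The general \<open>H\<close> covers both the vector-valued kernels and their scalar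
  coordinates.\<close>

lemma exp_decaying_integrable:
  fixes H :: "real \<Rightarrow> 'a::euclidean_space \<Rightarrow> 'b::euclidean_space"
  assumes g: "exp_decaying L C c g" and "0 < C"
    and A: "A \<in> sets lborel" "A \<subseteq> {L..}"
    and H: "continuous_on UNIV (\<lambda>p. H (fst p) (snd p))" "\<And>y. H y 0 = 0"
    and M: "0 \<le> M" "\<And>y z. y \<in> A \<Longrightarrow> norm (H y z) \<le> M * norm z"
  shows "set_integrable lborel A (\<lambda>y. H y (g y))"
proof (rule set_integrable_bound)
  show "set_integrable lborel A (\<lambda>y. (M * c) * exp (- C * y))"
    by (rule set_integrable_subset [where A = "{L..}"])
      (use A exp_decay_integral [OF \<open>0 < C\<close>] in auto)
  \<comment> \<open>Measurability of \<open>g\<close> is known only on \<open>{L..}\<close>, so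
    \<open>g\<close> is cut off before \<open>H\<close> is applied; \<open>H y 0 = 0\<close> makes
    the cut-off commute with \<open>H\<close>.\<close>
  have "(\<lambda>y. indicator A y *\<^sub>R (indicator {L..} y *\<^sub>R g y)) \<in> borel_measurable lborel"
    by (rule borel_measurable_scaleR [OF borel_measurable_indicator [OF A(1)]])
      (use g in \<open>simp add: exp_decaying_def set_borel_measurable_def\<close>)
  then have "(\<lambda>y. H y (indicator A y *\<^sub>R (indicator {L..} y *\<^sub>R g y))) \<in> borel_measurable lborel"
    by (intro borel_measurable_continuous_Pair [OF _ _ H(1)]) auto
  moreover have "H y (indicator A y *\<^sub>R (indicator {L..} y *\<^sub>R g y)) = indicator A y *\<^sub>R H y (g y)" for y
    using A(2) H(2) by (auto simp: indicator_def)
  ultimately show "set_borel_measurable lborel A (\<lambda>y. H y (g y))"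
    by (simp add: set_borel_measurable_def)
  have "AE y in lborel. L \<le> y \<longrightarrow> norm (g y) \<le> c * exp (- C * y)"
    using g by (simp add: exp_decaying_def)
  then show "AE y in lborel. y \<in> A \<longrightarrow> norm (H y (g y)) \<le> norm (M * c * exp (- C * y))"
  proof eventually_elim
    case (elim y)
    show ?case
    proof
      assume y: "y \<in> A"
      then have "norm (H y (g y)) \<le> M * (c * exp (- C * y))"
        using A(2) elim M by (meson atLeast_iff mult_left_mono order.trans subsetD)
      then show "norm (H y (g y)) \<le> norm (M * c * exp (- C * y))"
        by simp
    qed
  qed
qed

lemma set_integral_norm_le_exp_decay:
  fixes f :: "real \<Rightarrow> 'b::euclidean_space"
  assumes "set_integrable lborel A f" "A \<in> sets lborel" "A \<subseteq> {L..}" "0 < C"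
    and "AE y in lborel. y \<in> A \<longrightarrow> norm (f y) \<le> M * exp (- C * y)"
  shows "norm (LINT y:A|lborel. f y) \<le> M * (LINT y:A|lborel. exp (- C * y))"
proof -
  have "norm (LINT y:A|lborel. f y) \<le> (LINT y:A|lborel. norm (f y))"
    by (rule set_integral_norm_bound) fact
  also have "\<dots> \<le> (LINT y:A|lborel. M * exp (- C * y))"
  proof (rule set_integral_mono_AE)
    show "set_integrable lborel A (\<lambda>y. norm (f y))"
      by (rule set_integrable_norm) fact
    show "set_integrable lborel A (\<lambda>y. M * exp (- C * y))"
      by (rule set_integrable_subset [where A = "{L..}"])
        (use assms exp_decay_integral [OF \<open>0 < C\<close>] in auto)
    show "AE y\<in>A in lborel. norm (f y) \<le> M * exp (- C * y)"
      by fact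
  qed
  finally show ?thesis
    by simp
qed

text \<open>The exponential of \<open>t\<close> times the matrix with eigenvalues
  \<open>\<nu>\<close>, composed with its spectral projection for \<open>S\<close>, in
  eigencoordinates. In this form the bounds and the continuity of the integrands are
  elementary.\<close>

definition kern :: "complex^'n^'n \<Rightarrow> complex^'n^'n \<Rightarrow> ('n \<Rightarrow> complex) \<Rightarrow> complex set \<Rightarrow> real
    \<Rightarrow> complex^'n \<Rightarrow> complex^'n" where
  "kern V G \<nu> S t z = V *v (\<chi> k. if \<nu> k \<in> S then exp (of_real t * \<nu> k) * (G *v z) $ k else 0)"

lemma mexp_spectral_proj:
  assumes "V ** G = mat 1" "G ** V = mat 1"
  shows "mexp (t *\<^sub>R (V ** dg \<nu> ** G)) *v (spectral_proj (V ** dg \<nu> ** G) S *v z) = kern V G \<nu> S t z"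
proof -
  have "t *\<^sub>R (V ** dg \<nu> ** G) = V ** dg (\<lambda>k. of_real t * \<nu> k) ** G"
    by (simp add: vec_eq_iff conj_dg_entry scaleR_sum_right) (simp add: scaleR_conv_of_real algebra_simps)
  moreover have "V ** dg (\<lambda>k. exp (of_real t * \<nu> k)) ** G ** (V ** dg (\<lambda>k. if \<nu> k \<in> S then 1 else 0) ** G)
      = V ** dg (\<lambda>k. exp (of_real t * \<nu> k) * (if \<nu> k \<in> S then 1 else 0)) ** G"
    by (rule conj_dg_mult [OF assms(2)])
  moreover have "V ** dg (\<lambda>k. exp (of_real t * \<nu> k) * (if \<nu> k \<in> S then 1 else 0)) ** G *v z = kern V G \<nu> S t z"
    unfolding kern_def matrix_vector_mul_assoc [symmetric]
    by (rule arg_cong [where f = "(*v) V"]) (simp add: vec_eq_iff)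
  ultimately show ?thesis
    by (simp add: mexp_conj_dg [OF assms] spectral_proj_conj_dg [OF assms] matrix_vector_mul_assoc)
qed

lemma kern_coord:
  assumes "G ** V = mat 1"
  shows "(G *v kern V G \<nu> S t z) $ k = (if \<nu> k \<in> S then exp (of_real t * \<nu> k) * (G *v z) $ k else 0)"
  by (simp add: kern_def matrix_vector_mul_assoc assms)

text \<open>Every surviving coordinate is multiplied by a number of modulus at most 1, so only the
  change of basis and its inverse cost anything. This is where the condition number
  \<open>K_cond\<close> comes from.\<close>

lemma norm_kern_le:
  assumes "\<And>k. \<nu> k \<in> S \<Longrightarrow> t * Re (\<nu> k) \<le> 0"
  shows "norm (kern V G \<nu> S t z) \<le> opnorm V * opnorm G * norm z"
proof -
  have "norm (kern V G \<nu> S t z) \<le> opnorm V * norm (\<chi> k. if \<nu> k \<in> S then exp (of_real t * \<nu> k) * (G *v z) $ k else 0)"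
    unfolding kern_def by (rule norm_matrix_vector_le)
  also have "\<dots> \<le> opnorm V * norm (G *v z)"
  proof (intro mult_left_mono norm_le_componentwise opnorm_nonneg)
    fix k
    have "norm (exp (of_real t * \<nu> k) * (G *v z) $ k) \<le> norm ((G *v z) $ k)" if "\<nu> k \<in> S"
      using assms [OF that] by (simp add: norm_mult mult_left_le_one_le)
    then show "norm ((\<chi> k. if \<nu> k \<in> S then exp (of_real t * \<nu> k) * (G *v z) $ k else 0) $ k)
        \<le> norm ((G *v z) $ k)"
      by simp
  qed
  also have "\<dots> \<le> opnorm V * (opnorm G * norm z)"
    by (intro mult_left_mono norm_matrix_vector_le opnorm_nonneg)
  finally show ?thesis
    by (simp add: mult.assoc)
qed

lemma kern_0 [simp]: "kern V G \<nu> S t 0 = 0"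
proof -
  have "(\<chi> k. if \<nu> k \<in> S then exp (of_real t * \<nu> k) * (G *v 0) $ k else 0) = 0"
    by (simp add: vec_eq_iff)
  then show ?thesis
    by (simp add: kern_def)
qed

lemma kern_diff: "kern V G \<nu> S t (z - z') = kern V G \<nu> S t z - kern V G \<nu> S t z'"
proof -
  have "(\<chi> k. if \<nu> k \<in> S then exp (of_real t * \<nu> k) * (G *v (z - z')) $ k else 0)
     = (\<chi> k. if \<nu> k \<in> S then exp (of_real t * \<nu> k) * (G *v z) $ k else 0)
     - (\<chi> k. if \<nu> k \<in> S then exp (of_real t * \<nu> k) * (G *v z') $ k else 0)"
    by (simp add: vec_eq_iff matrix_vector_mult_diff_distrib algebra_simps)
  then show ?thesis
    by (simp add: kern_def matrix_vector_mult_diff_distrib)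
qed

lemma continuous_on_mult_vec [continuous_intros]:
  fixes A :: "'a::{euclidean_space,real_normed_field}^'n^'m"
  assumes "continuous_on S f"
  shows "continuous_on S (\<lambda>x. A *v f x)"
  by (rule continuous_on_compose2 [OF matrix_vector_mult_linear_continuous_on assms]) auto

lemma continuous_kern: "continuous_on UNIV (\<lambda>p. kern V G \<nu> S (x - fst p) (snd p))"
proof -
  have "continuous_on UNIV (\<lambda>p. if \<nu> k \<in> S then exp (of_real (x - fst p) * \<nu> k) * (G *v snd p) $ k else 0)" for k
    by (cases "\<nu> k \<in> S") (auto intro!: continuous_intros)
  then show ?thesis
    unfolding kern_def by (intro continuous_intros)
qed

text \<open>The integral part of \<open>F_plus\<close>: decaying modes are integrated forward from
  \<open>L\<close>, all others backward from infinity.\<close>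

definition dich :: "complex^'n^'n \<Rightarrow> complex^'n^'n \<Rightarrow> ('n \<Rightarrow> complex) \<Rightarrow> real \<Rightarrow> (real \<Rightarrow> complex^'n)
    \<Rightarrow> real \<Rightarrow> complex^'n" where
  "dich V G \<nu> L g x = (LINT y:{L..x}|lborel. kern V G \<nu> {z. Re z < 0} (x - y) (g y))
     - (LINT y:{x..}|lborel. kern V G \<nu> {z. Re z \<ge> 0} (x - y) (g y))"

lemma kern_integrable:
  assumes "exp_decaying L C c g" "0 < C" "L \<le> x"
  shows "set_integrable lborel {L..x} (\<lambda>y. kern V G \<nu> {z. Re z < 0} (x - y) (g y))"
    and "set_integrable lborel {x..} (\<lambda>y. kern V G \<nu> {z. Re z \<ge> 0} (x - y) (g y))"
proof -
  have K: "0 \<le> opnorm V * opnorm G"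
    by (simp add: opnorm_nonneg)
  show "set_integrable lborel {L..x} (\<lambda>y. kern V G \<nu> {z. Re z < 0} (x - y) (g y))"
    by (rule exp_decaying_integrable [OF assms(1,2) _ _ continuous_kern kern_0 K norm_kern_le])
      (auto simp: mult_nonneg_nonpos)
  show "set_integrable lborel {x..} (\<lambda>y. kern V G \<nu> {z. Re z \<ge> 0} (x - y) (g y))"
    by (rule exp_decaying_integrable [OF assms(1,2) _ _ continuous_kern kern_0 K norm_kern_le])
      (use assms(3) in \<open>auto simp: mult_nonpos_nonneg\<close>)
qed

lemma norm_dich_le:
  assumes g: "exp_decaying L C c g" and "0 < C" "L \<le> x"
  shows "norm (dich V G \<nu> L g x) \<le> opnorm V * opnorm G * c * (exp (- C * L) / C)"
proof -
  let ?K = "opnorm V * opnorm G"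
  note int = kern_integrable [OF assms]
  have K: "0 \<le> ?K"
    by (simp add: opnorm_nonneg)
  have AE: "AE y in lborel. L \<le> y \<longrightarrow> norm (g y) \<le> c * exp (- C * y)"
    using g by (simp add: exp_decaying_def)
  have bound: "norm (kern V G \<nu> S (x - y) (g y)) \<le> ?K * c * exp (- C * y)"
    if "norm (g y) \<le> c * exp (- C * y)" "\<And>k. \<nu> k \<in> S \<Longrightarrow> (x - y) * Re (\<nu> k) \<le> 0" for S y
  proof -
    have "norm (kern V G \<nu> S (x - y) (g y)) \<le> ?K * norm (g y)"
      by (rule norm_kern_le) (rule that)
    also have "\<dots> \<le> ?K * (c * exp (- C * y))"
      by (rule mult_left_mono [OF that(1) K])
    finally show ?thesis
      by (simp add: mult.assoc)
  qed
  have 1: "norm (LINT y:{L..x}|lborel. kern V G \<nu> {z. Re z < 0} (x - y) (g y))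
      \<le> ?K * c * (LINT y:{L..x}|lborel. exp (- C * y))"
    by (rule set_integral_norm_le_exp_decay [OF int(1) _ _ \<open>0 < C\<close>, where L = L])
      (auto intro!: eventually_mono [OF AE] bound [simplified] mult_nonneg_nonpos)
  have 2: "norm (LINT y:{x..}|lborel. kern V G \<nu> {z. Re z \<ge> 0} (x - y) (g y))
      \<le> ?K * c * (LINT y:{x..}|lborel. exp (- C * y))"
    by (rule set_integral_norm_le_exp_decay [OF int(2) _ _ \<open>0 < C\<close>, where L = L])
      (use \<open>L \<le> x\<close> in \<open>auto intro!: eventually_mono [OF AE] bound [simplified] mult_nonpos_nonneg\<close>)
  have "(LINT y:{L..x}|lborel. exp (- C * y)) = - exp (- C * x) / C - (- exp (- C * L) / C)"
    unfolding set_lebesgue_integral_def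
    by (rule integral_FTC_atLeastAtMost)
      (use assms in \<open>auto intro!: derivative_eq_intros continuous_intros
         simp flip: has_real_derivative_iff_has_vector_derivative\<close>)
  \<comment> \<open>Both kernels have the same bound, and the two domains together make up
    \<open>{L..}\<close>. Hence the condition number enters once and the estimate does not depend on
    \<open>x\<close>.\<close>
  then have sum: "(LINT y:{L..x}|lborel. exp (- C * y)) + (LINT y:{x..}|lborel. exp (- C * y)) = exp (- C * L) / C"
    unfolding exp_decay_integral(2) [OF \<open>0 < C\<close>] by simp
  have "norm (dich V G \<nu> L g x) \<le> ?K * c * (LINT y:{L..x}|lborel. exp (- C * y))
      + ?K * c * (LINT y:{x..}|lborel. exp (- C * y))"
    unfolding dich_def by (rule order.trans [OF norm_triangle_ineq4 add_mono [OF 1 2]])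
  also have "\<dots> = ?K * c * (exp (- C * L) / C)"
    by (simp only: sum flip: distrib_left)
  finally show ?thesis .
qed

lemma dich_diff:
  assumes "exp_decaying L C c g" "exp_decaying L C' c' g'" "0 < C" "0 < C'" "L \<le> x"
  shows "dich V G \<nu> L (\<lambda>y. g y - g' y) x = dich V G \<nu> L g x - dich V G \<nu> L g' x"
  using kern_integrable [OF assms(1,3,5)] kern_integrable [OF assms(2,4,5)]
  by (simp add: dich_def kern_diff set_integral_diff)

lemma bounded_linear_coord: "bounded_linear (\<lambda>z. (A *v z) $ k)"
  for A :: "'a::{euclidean_space,real_normed_field}^'n^'m"
  using bounded_linear_compose [OF bounded_linear_vec_nth matrix_vector_mul_bounded_linear] .

lemma set_integral_bounded_linear:
  assumes "bounded_linear T" "set_integrable M A f"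
  shows "T (LINT x:A|M. f x) = (LINT x:A|M. T (f x))"
  using integral_bounded_linear [OF assms(1), of M "\<lambda>x. indicator A x *\<^sub>R f x"] assms
  by (simp add: set_lebesgue_integral_def set_integrable_def linear_simps bounded_linear.linear)

text \<open>For a mode with nonnegative real part, the integral over \<open>{x..}\<close> is the one
  over \<open>{L..}\<close> minus the one over \<open>{L..x}\<close>. After factoring out the
  exponential in \<open>x\<close>, both kinds of modes thus have the same form, a constant plus an
  integral from \<open>L\<close>, to which the fundamental theorem of calculus applies.\<close>

lemma dich_coord:
  fixes V G :: "complex^'n^'n"
  assumes GV: "G ** V = mat 1" and g: "exp_decaying L C c g" and "0 < C"
  obtains a where
    "\<And>x. L \<le> x \<Longrightarrow> (\<lambda>y. exp (- (of_real y * \<nu> k)) * (G *v g y) $ k) integrable_on {L..x}"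
    "\<And>x. L \<le> x \<Longrightarrow> (G *v dich V G \<nu> L g x) $ k
       = exp (of_real x * \<nu> k) * (a + integral {L..x} (\<lambda>y. exp (- (of_real y * \<nu> k)) * (G *v g y) $ k))"
proof -
  define h where "h y = exp (- (of_real y * \<nu> k)) * (G *v g y) $ k" for y
  have cont: "continuous_on UNIV (\<lambda>p :: real \<times> (complex^'n). exp (- (of_real (fst p) * \<nu> k)) * (G *v snd p) $ k)"
    by (intro continuous_intros)
  obtain B where B: "0 \<le> B" "\<And>z. norm ((G *v z) $ k) \<le> norm z * B"
    using bounded_linear.nonneg_bounded [OF bounded_linear_coord [of G k]] by blast
  have int: "set_integrable lborel A h" 
    if "A \<in> sets lborel" "A \<subseteq> {L..}" "0 \<le> M" "\<And>y. y \<in> A \<Longrightarrow> exp (- (y * Re (\<nu> k))) \<le> M" for A M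
    unfolding h_def
  proof (rule exp_decaying_integrable [OF g \<open>0 < C\<close> that(1,2) cont, where M = "M * B"])
    show "0 \<le> M * B"
      using that B by simp
    fix y z assume "y \<in> A"
    then have "norm (exp (- (of_real y * \<nu> k))) * norm ((G *v z) $ k) \<le> M * (norm z * B)"
      by (intro mult_mono) (use that B in auto)
    then show "norm (exp (- (of_real y * \<nu> k)) * (G *v z) $ k) \<le> M * B * norm z"
      by (simp add: norm_mult ac_simps)
  qed simp
  have int1: "set_integrable lborel {L..x} h" if "L \<le> x" for x
  proof (rule int)
    fix y assume "y \<in> {L..x}"
    then have "\<bar>y * Re (\<nu> k)\<bar> \<le> (\<bar>L\<bar> + \<bar>x\<bar>) * \<bar>Re (\<nu> k)\<bar>"
      by (simp only: abs_mult) (intro mult_right_mono, auto)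
    then show "exp (- (y * Re (\<nu> k))) \<le> exp ((\<bar>L\<bar> + \<bar>x\<bar>) * \<bar>Re (\<nu> k)\<bar>)"
      by simp
  qed auto
  have exp_split: "exp ((of_real x - of_real y) * \<nu> k) * z = exp (of_real x * \<nu> k) * (exp (- (of_real y * \<nu> k)) * z)" for x y z
    by (simp add: algebra_simps flip: exp_add mult.assoc)
  define a where "a = (if Re (\<nu> k) < 0 then 0 else - (LINT y:{L..}|lborel. h y))"
  have "(G *v dich V G \<nu> L g x) $ k = exp (of_real x * \<nu> k) * (a + integral {L..x} h)" if "L \<le> x" for x
  proof -
    note ki = kern_integrable [OF g \<open>0 < C\<close> that]
    have "(G *v dich V G \<nu> L g x) $ k =
        (LINT y:{L..x}|lborel. (G *v kern V G \<nu> {z. Re z < 0} (x - y) (g y)) $ k)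
      - (LINT y:{x..}|lborel. (G *v kern V G \<nu> {z. Re z \<ge> 0} (x - y) (g y)) $ k)"
      unfolding dich_def
      by (simp add: matrix_vector_mult_diff_distrib set_integral_bounded_linear [OF bounded_linear_coord] ki)
    also have "\<dots> = exp (of_real x * \<nu> k) * (a + (LINT y:{L..x}|lborel. h y))"
    proof (cases "Re (\<nu> k) < 0")
      case True
      then show ?thesis
        by (simp add: kern_coord [OF GV] a_def exp_split h_def)
    next
      case False
      have "set_integrable lborel {L..} h"
        by (rule int [where M = "exp (- (L * Re (\<nu> k)))"])
          (use False in \<open>auto intro: mult_right_mono\<close>)
      then have hx: "set_integrable lborel {x..} h"
        by (rule set_integrable_subset) (use that in auto)
      have "(LINT y:{L..x} \<union> {x..}|lborel. h y) = (LINT y:{L..x}|lborel. h y) + (LINT y:{x..}|lborel. h y)"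
      proof (rule set_integral_Un_AE)
        show "AE y in lborel. \<not> (y \<in> {L..x} \<and> y \<in> {x..})"
          using AE_lborel_singleton [of x] by eventually_elim auto
      qed (use int1 [OF that] hx in auto)
      moreover have "{L..x} \<union> {x..} = {L..}"
        using that by auto
      ultimately have "(LINT y:{L..}|lborel. h y) = (LINT y:{L..x}|lborel. h y) + (LINT y:{x..}|lborel. h y)"
        by simp
      moreover have "(LINT y:{x..}|lborel. (G *v kern V G \<nu> {z. Re z \<ge> 0} (x - y) (g y)) $ k)
          = exp (of_real x * \<nu> k) * (LINT y:{x..}|lborel. h y)"
        using False by (simp add: kern_coord [OF GV] exp_split h_def)
      moreover have "(LINT y:{L..x}|lborel. (G *v kern V G \<nu> {z. Re z < 0} (x - y) (g y)) $ k) = 0"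
        using False by (simp add: kern_coord [OF GV])
      ultimately show ?thesis
        using False by (simp add: a_def)
    qed
    also have "(LINT y:{L..x}|lborel. h y) = integral {L..x} h"
      by (rule set_borel_integral_eq_integral) (rule int1 [OF that])
    finally show ?thesis .
  qed
  moreover have "h integrable_on {L..x}" if "L \<le> x" for x
    by (rule set_borel_integral_eq_integral) (rule int1 [OF that])
  ultimately show ?thesis
    using that unfolding h_def by blast
qed

text \<open>Transfers calculus on compact intervals to the half-line, with one-sided derivatives at
  \<open>L\<close>.\<close>

lemma at_within_atLeast_eq: "L \<le> x \<Longrightarrow> at x within {L..x + 1} = at x within {L..}"
  for x :: real
  by (rule at_within_nhd [where S = "{..<x + 1}"]) auto

lemma continuous_dich:
  fixes V G :: "complex^'n^'n"
  assumes VG: "V ** G = mat 1" "G ** V = mat 1" and g: "exp_decaying L C c g" and "0 < C"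
  shows "continuous_on {L..} (dich V G \<nu> L g)"
proof -
  have "continuous_on {L..} (\<lambda>x. (G *v dich V G \<nu> L g x) $ k)" for k
  proof -
    obtain a where int: "\<And>x. L \<le> x \<Longrightarrow> (\<lambda>y. exp (- (of_real y * \<nu> k)) * (G *v g y) $ k) integrable_on {L..x}"
      and eq: "\<And>x. L \<le> x \<Longrightarrow> (G *v dich V G \<nu> L g x) $ k
       = exp (of_real x * \<nu> k) * (a + integral {L..x} (\<lambda>y. exp (- (of_real y * \<nu> k)) * (G *v g y) $ k))"
      using dich_coord [OF VG(2) g \<open>0 < C\<close>] by blast
    have "continuous_on {L..} (\<lambda>x. integral {L..x} (\<lambda>y. exp (- (of_real y * \<nu> k)) * (G *v g y) $ k))"
      unfolding continuous_on_eq_continuous_within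
    proof
      fix x assume x: "x \<in> {L..}"
      have "continuous_on {L..x + 1} (\<lambda>x. integral {L..x} (\<lambda>y. exp (- (of_real y * \<nu> k)) * (G *v g y) $ k))"
        by (rule indefinite_integral_continuous_1) (use x int in auto)
      then show "continuous (at x within {L..}) (\<lambda>x. integral {L..x} (\<lambda>y. exp (- (of_real y * \<nu> k)) * (G *v g y) $ k))"
        using x by (simp add: continuous_on_eq_continuous_within flip: at_within_atLeast_eq)
    qed
    then show ?thesis
      by (subst continuous_on_cong [OF refl eq]) (auto intro!: continuous_intros)
  qed
  then have "continuous_on {L..} (\<lambda>x. V *v (\<chi> k. (G *v dich V G \<nu> L g x) $ k))"
    by (intro continuous_on_mult_vec continuous_on_vec_lambda)
  then show ?thesis
    by (simp add: matrix_vector_mul_assoc VG)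
qed

lemma has_vector_derivative_vecI:
  fixes f :: "real \<Rightarrow> complex^'n"
  assumes "\<And>k. ((\<lambda>x. f x $ k) has_vector_derivative f' $ k) F"
  shows "(f has_vector_derivative f') F"
proof -
  have "bounded_linear (\<lambda>z :: complex. z *s axis k (1 :: complex) :: complex^'n)" for k
    by (rule bounded_linear_intro [where K = "norm (axis k (1 :: complex) :: complex^'n)"])
      (simp_all add: vec_eq_iff algebra_simps norm_smult_vec)
  then have "((\<lambda>x. \<Sum>k\<in>UNIV. f x $ k *s axis k 1) has_vector_derivative (\<Sum>k\<in>UNIV. f' $ k *s axis k 1)) F"
    by (intro has_vector_derivative_sum bounded_linear.has_vector_derivative [where f = "\<lambda>z. z *s axis _ 1"] assms)
  then show ?thesis
    by (simp add: basis_expansion)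
qed

text \<open>Product rule on the coordinate formula: the exponential yields the linear term, the
  integral yields the forcing.\<close>

lemma dich_derivative:
  fixes V G :: "complex^'n^'n"
  assumes VG: "V ** G = mat 1" "G ** V = mat 1" and g: "exp_decaying L C c g" and "0 < C"
    and cont: "continuous_on {L..} g" and x: "L \<le> x"
  shows "(dich V G \<nu> L g has_vector_derivative ((V ** dg \<nu> ** G) *v dich V G \<nu> L g x + g x)) (at x within {L..})"
proof -
  have "((\<lambda>x. (G *v dich V G \<nu> L g x) $ k) has_vector_derivative
      (\<nu> k * (G *v dich V G \<nu> L g x) $ k + (G *v g x) $ k)) (at x within {L..})" for k
  proof -
    define h where "h y = exp (- (of_real y * \<nu> k)) * (G *v g y) $ k" for y
    obtain a where eq: "\<And>x. L \<le> x \<Longrightarrow> (G *v dich V G \<nu> L g x) $ k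
       = exp (of_real x * \<nu> k) * (a + integral {L..x} h)"
      using dich_coord [OF VG(2) g \<open>0 < C\<close>] unfolding h_def by blast
    have "continuous_on {L..} h"
      unfolding h_def by (intro continuous_intros cont)
    then have "((\<lambda>u. integral {L..u} h) has_vector_derivative h x) (at x within {L..x + 1})"
      by (intro integral_has_vector_derivative) (use x in \<open>auto elim: continuous_on_subset\<close>)
    then have "((\<lambda>u. integral {L..u} h) has_vector_derivative h x) (at x within {L..})"
      by (simp add: at_within_atLeast_eq x)
    moreover have "((\<lambda>u. exp (of_real u * \<nu> k)) has_vector_derivative (\<nu> k * exp (of_real x * \<nu> k))) (at x within {L..})"
      by (rule has_vector_derivative_real_field) (auto intro!: derivative_eq_intros)
    ultimately have "((\<lambda>u. exp (of_real u * \<nu> k) * (a + integral {L..u} h)) has_vector_derivative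
      (exp (of_real x * \<nu> k) * h x + \<nu> k * exp (of_real x * \<nu> k) * (a + integral {L..x} h))) (at x within {L..})"
      by (auto intro!: derivative_eq_intros)
    moreover have "exp (of_real x * \<nu> k) * h x = (G *v g x) $ k"
      by (simp add: h_def flip: exp_add mult.assoc)
    ultimately have "((\<lambda>u. exp (of_real u * \<nu> k) * (a + integral {L..u} h)) has_vector_derivative
      (\<nu> k * (G *v dich V G \<nu> L g x) $ k + (G *v g x) $ k)) (at x within {L..})"
      by (simp add: eq x algebra_simps)
    then show ?thesis
      by (rule has_vector_derivative_transform_within [OF _ zero_less_one]) (use x eq in auto)
  qed
  then have "((\<lambda>x. G *v dich V G \<nu> L g x) has_vector_derivative
      (dg \<nu> *v (G *v dich V G \<nu> L g x) + G *v g x)) (at x within {L..})"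
    by (intro has_vector_derivative_vecI) simp
  then have "((\<lambda>x. V *v (G *v dich V G \<nu> L g x)) has_vector_derivative
      V *v (dg \<nu> *v (G *v dich V G \<nu> L g x) + G *v g x)) (at x within {L..})"
    by (rule bounded_linear.has_vector_derivative [OF matrix_vector_mul_bounded_linear])
  then show ?thesis
    by (simp add: matrix_vector_mul_assoc VG matrix_vector_right_distrib matrix_mul_assoc)
qed

section \<open>Eigenvalues and eigenvectors of the asymptotic system\<close>

definition cnjv :: "complex^'n \<Rightarrow> complex^'n" where
  "cnjv v = (\<chi> i. cnj (v $ i))"

lemma cnjv_nth [simp]: "cnjv v $ i = cnj (v $ i)"
  by (simp add: cnjv_def)

lemma cnjv_algebra:
  "cnjv (u + v) = cnjv u + cnjv v" "cnjv (u - v) = cnjv u - cnjv v" "cnjv (c *s v) = cnj c *s cnjv v"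
  "cnjv (cnjv v) = v"
  by (simp_all add: vec_eq_iff)

lemma norm_cnjv [simp]: "norm (cnjv v) = norm v"
  by (simp add: norm_vec_def)

lemma bounded_linear_cnjv: "bounded_linear cnjv"
  by (rule bounded_linear_intro [where K = 1]) (simp_all add: cnjv_algebra vec_eq_iff)

lemma theta_props:
  assumes "0 < m"
  shows "pi / 2 < theta m" "theta m < pi" "cos (theta m) = - (1 / rho m)"
proof -
  have "theta m = pi - arctan (sqrt m)"
    unfolding theta_def
  proof (rule the_equality)
    show "pi / 2 < pi - arctan (sqrt m) \<and> pi - arctan (sqrt m) < pi \<and> tan (pi - arctan (sqrt m)) = - sqrt m"
      using arctan_ubound [of "sqrt m"] assms by (simp add: tan_def tan_arctan [unfolded tan_def])
  next
    fix t assume t: "pi / 2 < t \<and> t < pi \<and> tan t = - sqrt m"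
    then have "tan (pi - t) = sqrt m"
      by (simp add: tan_def)
    then have "arctan (sqrt m) = pi - t"
      using t by (intro arctan_unique) auto
    then show "t = pi - arctan (sqrt m)"
      by simp
  qed
  then show "pi / 2 < theta m" "theta m < pi" "cos (theta m) = - (1 / rho m)"
    using arctan_ubound [of "sqrt m"] assms by (simp_all add: cos_arctan rho_def)
qed

text \<open>
  This is \<open>exp (- i \<theta> / 2) / sqrt \<rho>\<close>: the eigenvalues and the entries of the eigenvectors are polynomials in
  \<open>dd m\<close>, its conjugate and \<open>\<rho>\<close>, subject only to \<open>\<rho> |dd|\<^sup>2 = 1\<close> and \<open>\<rho>\<^sup>2 Re (dd\<^sup>2) = -1\<close>.
\<close>

definition dd :: "real \<Rightarrow> complex" where
  "dd m = complex_of_real (1 / sqrt (rho m)) * cis (- (theta m / 2))"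

lemma rho_gt_1: "0 < m \<Longrightarrow> 1 < rho m"
  by (simp add: rho_def)

lemma rho_sq: "0 < m \<Longrightarrow> (rho m)\<^sup>2 = 1 + m"
  by (simp add: rho_def)

lemma dd_props:
  assumes "0 < m"
  shows "0 < Re (dd m)" "Im (dd m) < 0" "rho m * ((Re (dd m))\<^sup>2 + (Im (dd m))\<^sup>2) = 1"
    "(rho m)\<^sup>2 * ((Im (dd m))\<^sup>2 - (Re (dd m))\<^sup>2) = 1"
proof -
  note th = theta_props [OF assms] and rho = rho_gt_1 [OF assms]
  have c: "0 < cos (theta m / 2)" and s: "0 < sin (theta m / 2)"
    using th by (auto intro: cos_gt_zero sin_gt_zero)
  show "0 < Re (dd m)" "Im (dd m) < 0"
    using c s rho by (simp_all add: dd_def)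
  have "(Re (dd m))\<^sup>2 = (cos (theta m / 2))\<^sup>2 / rho m" "(Im (dd m))\<^sup>2 = (sin (theta m / 2))\<^sup>2 / rho m"
    using rho by (simp_all add: dd_def power_divide)
  then have 1: "(Re (dd m))\<^sup>2 + (Im (dd m))\<^sup>2 = 1 / rho m"
    "(Im (dd m))\<^sup>2 - (Re (dd m))\<^sup>2 = - cos (theta m) / rho m"
    using cos_double [of "theta m / 2"] by (simp_all add: diff_divide_distrib flip: add_divide_distrib)
  then show "rho m * ((Re (dd m))\<^sup>2 + (Im (dd m))\<^sup>2) = 1"
    "(rho m)\<^sup>2 * ((Im (dd m))\<^sup>2 - (Re (dd m))\<^sup>2) = 1"
    using rho th(3) by (simp_all add: power2_eq_square)
qed

lemma rho_dd_cnj: "0 < m \<Longrightarrow> of_real (rho m) * (dd m * cnj (dd m)) = 1"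
  using dd_props(3) [of m] by (simp add: complex_mult_cnj del: of_real_add flip: of_real_mult)

lemma rho_dd_sq:
  assumes "0 < m"
  shows "(of_real (rho m))\<^sup>2 * ((dd m)\<^sup>2 + (cnj (dd m))\<^sup>2) = - 2" (is "?z = _")
proof -
  have "Re ?z = - 2" "Im ?z = 0"
    using dd_props(4) [OF assms]
    by (simp_all add: power2_eq_square [of "dd m"] power2_eq_square [of "cnj (dd m)"] flip: of_real_power)
      (simp add: power2_eq_square algebra_simps)
  then show ?thesis
    by (simp add: complex_eq_iff)
qed

lemma of_real_rho: "0 < m \<Longrightarrow> complex_of_real (rho m) = of_real (sqrt (rho m)) * of_real (sqrt (rho m))"
  using rho_gt_1 [of m] by (simp flip: of_real_mult)

lemma mu1u_eq: "0 < m \<Longrightarrow> mu1u m = of_real (rho m) * cnj (dd m)"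
  and mu2u_eq: "0 < m \<Longrightarrow> mu2u m = of_real (rho m) * dd m"
  using rho_gt_1 [of m] by (simp_all add: mu1u_def mu2u_def dd_def cis_cnj of_real_rho)

lemma V_eq:
  assumes "0 < m"
  shows "V1u m = vector [(dd m)\<^sup>2, 1, mu1u m + 2 * dd m, dd m]"
    and "V1s m = vector [(dd m)\<^sup>2, 1, - (mu1u m + 2 * dd m), - dd m]"
    and "V2u m = vector [(cnj (dd m))\<^sup>2, 1, mu2u m + 2 * cnj (dd m), cnj (dd m)]"
    and "V2s m = vector [(cnj (dd m))\<^sup>2, 1, - (mu2u m + 2 * cnj (dd m)), - cnj (dd m)]"
proof -
  have d2: "complex_of_real (1 / rho m) * cis (- theta m) = (dd m)\<^sup>2"
    using rho_gt_1 [OF assms]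
    by (simp add: dd_def power_mult_distrib cis_mult power2_eq_square flip: of_real_mult mult.assoc)
  have c: "c_ev m = mu1u m + 2 * dd m"
    by (simp add: c_ev_def mu1u_def dd_def)
  show 1: "V1u m = vector [(dd m)\<^sup>2, 1, mu1u m + 2 * dd m, dd m]"
    "V1s m = vector [(dd m)\<^sup>2, 1, - (mu1u m + 2 * dd m), - dd m]"
    unfolding V1u_def V1s_def d2 c by (simp_all add: dd_def)
  show "V2u m = vector [(cnj (dd m))\<^sup>2, 1, mu2u m + 2 * cnj (dd m), cnj (dd m)]"
    "V2s m = vector [(cnj (dd m))\<^sup>2, 1, - (mu2u m + 2 * cnj (dd m)), - cnj (dd m)]"
    unfolding V2u_def V2s_def 1 by (simp_all add: vec_eq_iff forall_4 mu1u_eq mu2u_eq assms)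
qed

lemma V2_cnjv: "V2u m = cnjv (V1u m)" "V2s m = cnjv (V1s m)"
  by (simp_all add: V2u_def V2s_def cnjv_def)

lemma cnj_mu: "cnj (mu1u m) = mu2u m" "cnj (mu2u m) = mu1u m" "cnj (mu1s m) = mu2s m" "cnj (mu2s m) = mu1s m"
  by (simp_all add: mu1u_def mu2u_def mu1s_def mu2s_def cis_cnj)

lemma Re_mu:
  assumes "0 < m"
  shows "0 < Re (mu1u m)" "Re (mu2u m) = Re (mu1u m)"
  using dd_props(1) [OF assms] rho_gt_1 [OF assms] by (simp_all add: mu1u_eq mu2u_eq assms)

lemma norm_V_fst:
  assumes "0 < m"
  shows "norm (V1u m $ 1) = 1 / rho m" "norm (V1s m $ 1) = 1 / rho m"
    "norm (V2u m $ 1) = 1 / rho m" "norm (V2s m $ 1) = 1 / rho m"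
proof -
  have "(cmod (dd m))\<^sup>2 = 1 / rho m"
    using dd_props(3) [OF assms] rho_gt_1 [OF assms] by (simp add: cmod_power2 field_simps)
  then show "norm (V1u m $ 1) = 1 / rho m" "norm (V1s m $ 1) = 1 / rho m"
    "norm (V2u m $ 1) = 1 / rho m" "norm (V2s m $ 1) = 1 / rho m"
    by (simp_all add: V_eq assms norm_power)
qed

definition ev :: "real \<Rightarrow> 4 \<Rightarrow> complex" where
  "ev m k = vector [mu1s m, mu2s m, mu1u m, mu2u m] $ k"

lemma Vfull_mult: "Vfull m *v x = x $ 1 *s V1s m + x $ 2 *s V2s m + x $ 3 *s V1u m + x $ 4 *s V2u m"
  by (simp add: Vfull_def cols4_mult)

text \<open>Stable and unstable eigenvectors agree in components 1 and 2 and are opposite in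
  components 3 and 4. Sums and differences of coefficients therefore decouple into two 2 by 2
  systems, both governed by the nonzero number \<open>?d\<^sup>2 - (cnj ?d)\<^sup>2\<close>.\<close>

lemma invertible_Vfull:
  assumes "0 < m"
  shows "invertible (Vfull m)"
  unfolding invertible_iff_ker
proof (intro allI impI)
  fix x assume x: "Vfull m *v x = 0"
  let ?d = "dd m" and ?r = "complex_of_real (rho m)"
  have r: "?r \<noteq> 0" and d: "?d \<noteq> cnj ?d" "?d \<noteq> - cnj ?d"
    using dd_props(1,2) [OF assms] rho_gt_1 [OF assms] by (auto simp: complex_eq_iff)
  have d2: "?d\<^sup>2 - (cnj ?d)\<^sup>2 \<noteq> 0"
    using d by (simp add: power2_eq_iff)
  define s1 s2 t1 t2 where "s1 = x $ 1 + x $ 3" and "s2 = x $ 2 + x $ 4"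
    and "t1 = x $ 3 - x $ 1" and "t2 = x $ 4 - x $ 2"
  have e: "s1 * ?d\<^sup>2 + s2 * (cnj ?d)\<^sup>2 = 0" "s1 + s2 = 0"
    "t1 * (?r * cnj ?d + 2 * ?d) + t2 * (?r * ?d + 2 * cnj ?d) = 0" "t1 * ?d + t2 * cnj ?d = 0"
    using x unfolding Vfull_mult
    by (simp_all add: V_eq mu1u_eq mu2u_eq assms vec_eq_iff forall_4 s1_def s2_def t1_def t2_def algebra_simps)
  have "s1 * (?d\<^sup>2 - (cnj ?d)\<^sup>2) = 0"
    using e(1,2) by algebra
  then have s: "s1 = 0" "s2 = 0"
    using d2 e(2) by auto
  have "t1 * cnj ?d + t2 * ?d = 0"
    using e(3,4) r by algebra
  then have "t1 * (?d\<^sup>2 - (cnj ?d)\<^sup>2) = 0" "t2 * (?d\<^sup>2 - (cnj ?d)\<^sup>2) = 0"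
    using e(4) by algebra+
  then have t: "t1 = 0" "t2 = 0"
    using d2 by auto
  have "x $ 1 = 0" "x $ 2 = 0" "x $ 3 = 0" "x $ 4 = 0"
    using s t by (simp_all add: s1_def s2_def t1_def t2_def eq_neg_iff_add_eq_0) 
  then show "x = 0"
    by (simp add: vec_eq_iff forall_4)
qed

abbreviation Vinv :: "real \<Rightarrow> complex^4^4" where "Vinv m \<equiv> matrix_inv (Vfull m)"

lemma Vinv_mult:
  assumes "0 < m"
  shows "Vfull m ** Vinv m = mat 1" "Vinv m ** Vfull m = mat 1"
  using matrix_inv_mult [OF invertible_Vfull [OF assms]] .

text \<open>Complex conjugation in coordinates with respect to the columns of \<open>Vfull\<close>,
  which come in two conjugate pairs.\<close>

definition cnj_swap :: "complex^4 \<Rightarrow> complex^4" where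
  "cnj_swap z = vector [cnj (z $ 2), cnj (z $ 1), cnj (z $ 4), cnj (z $ 3)]"

lemma cnjv_Vfull: "cnjv (Vfull m *v z) = Vfull m *v cnj_swap z"
  by (simp add: Vfull_mult cnj_swap_def V2_cnjv cnjv_algebra algebra_simps)

lemma Vinv_cnjv:
  assumes "0 < m"
  shows "Vinv m *v cnjv w = cnj_swap (Vinv m *v w)"
proof -
  have "Vinv m *v (Vfull m *v cnj_swap (Vinv m *v w)) = cnj_swap (Vinv m *v w)"
    by (simp add: matrix_vector_mul_assoc Vinv_mult assms)
  then show ?thesis
    by (simp add: matrix_vector_mul_assoc Vinv_mult assms flip: cnjv_Vfull)
qed

text \<open>Conjugation exchanges the eigenvalues within each pair, and a conjugation-invariant
  \<open>S\<close> selects both or neither of the corresponding shifted eigenvalues.\<close>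

lemma cnjv_kern:
  assumes "0 < m" and S: "\<And>z. cnj z \<in> S \<longleftrightarrow> z \<in> S"
  shows "cnjv (kern (Vfull m) (Vinv m) (\<lambda>k. ev m k - \<mu>) S t z)
    = kern (Vfull m) (Vinv m) (\<lambda>k. ev m k - cnj \<mu>) S t (cnjv z)"
proof -
  have *: "mu2s m - cnj \<mu> \<in> S \<longleftrightarrow> mu1s m - \<mu> \<in> S" "mu1s m - cnj \<mu> \<in> S \<longleftrightarrow> mu2s m - \<mu> \<in> S"
    "mu2u m - cnj \<mu> \<in> S \<longleftrightarrow> mu1u m - \<mu> \<in> S" "mu1u m - cnj \<mu> \<in> S \<longleftrightarrow> mu2u m - \<mu> \<in> S"
    using S [of "mu1s m - \<mu>"] S [of "mu2s m - \<mu>"] S [of "mu1u m - \<mu>"] S [of "mu2u m - \<mu>"]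
    by (simp_all add: cnj_mu)
  show ?thesis
    unfolding kern_def cnjv_Vfull Vinv_cnjv [OF assms(1)]
    by (rule arg_cong [where f = "(*v) (Vfull m)"])
      (simp add: vec_eq_iff forall_4 cnj_swap_def ev_def * exp_cnj cnj_mu)
qed

section \<open>The linearization about the pulse\<close>

lemma deriv_sh_f: "deriv (sh_f m n) u = 2 * n * u - 3 * u\<^sup>2 - m"
  unfolding sh_f_def by (rule DERIV_imp_deriv) (auto intro!: derivative_eq_intros simp: power2_eq_square)

lemma cmat_mult: "cmat A *v x = (\<chi> i. \<Sum>j\<in>UNIV. complex_of_real (A $ i $ j) * x $ j)"
  by (simp add: cmat_def map_matrix_def matrix_vector_mult_def)

lemma cB_mult:
  "cB m n \<phi> x *v q = vector [q $ 4, q $ 3 - 2 * q $ 4, of_real (- 1 + deriv (sh_f m n) (\<phi> x)) * q $ 1, q $ 2]"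
  by (simp add: cmat_mult vec_eq_iff forall_4 sum_4 B_def)

locale pulse_frame =
  fixes m n :: real and \<phi> :: "real \<Rightarrow> real" and K_B C_B L :: real
  assumes m_pos: "0 < m"
    and pulse: "pulse m n \<phi>"
    and K_B: "0 < K_B" and C_B: "0 < C_B"
    and B_bound: "\<And>x. opnorm (B m n \<phi> x - B_inf m n \<phi>) \<le> K_B * exp (- C_B * \<bar>x\<bar>)"
    and L_pos: "0 < L"
    and tau: "tau_F m K_B C_B L < 1"
begin

abbreviation "Binf \<equiv> cmat (B_inf m n \<phi>)"
abbreviation "Bt y \<equiv> cmat (B_tilde m n \<phi> y)"
abbreviation "V \<equiv> Vfull m"
abbreviation "G \<equiv> Vinv m"
abbreviation "\<tau> \<equiv> tau_F m K_B C_B L"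

text \<open>The single nonzero entry of \<open>B_tilde\<close>, namely f'(\<phi>) - f'(0) with f'(0)
  = -m.\<close>

definition b :: "real \<Rightarrow> real" where
  "b y = 2 * n * \<phi> y - 3 * (\<phi> y)\<^sup>2"

lemma B_inf_eq:
  "B_inf m n \<phi> = vector [vector [0, 0, 0, 1], vector [0, 0, 1, -2], vector [- 1 - m, 0, 0, 0], vector [0, 1, 0, 0]]"
    (is "_ = ?M")
proof -
  have "(\<phi> \<longlongrightarrow> 0) at_infinity"
    using pulse by (simp add: pulse_def)
  then have "((\<lambda>x. - 1 + (2 * n * \<phi> x - 3 * (\<phi> x)\<^sup>2 - m)) \<longlongrightarrow> - 1 + (2 * n * 0 - 3 * 0\<^sup>2 - m)) at_infinity"
    by (intro tendsto_intros)
  then have lim: "((\<lambda>x. - 1 + deriv (sh_f m n) (\<phi> x)) \<longlongrightarrow> - 1 - m) at_infinity"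
    by (simp add: deriv_sh_f)
  have "((\<lambda>x. B m n \<phi> x $ i $ j) \<longlongrightarrow> ?M $ i $ j) at_infinity" for i j
  proof -
    have "\<forall>i j. ((\<lambda>x. B m n \<phi> x $ i $ j) \<longlongrightarrow> ?M $ i $ j) at_infinity"
      using lim by (simp add: forall_4 B_def)
    then show ?thesis
      by blast
  qed
  then have "(B m n \<phi> \<longlongrightarrow> ?M) at_infinity"
    by (intro vec_tendstoI)
  then show ?thesis
    unfolding B_inf_def by (intro tendsto_Lim) (simp_all add: trivial_limit_at_infinity)
qed

lemma Binf_mult: "Binf *v q = vector [q $ 4, q $ 3 - 2 * q $ 4, - (1 + of_real m) * q $ 1, q $ 2]"
  by (simp add: cmat_mult vec_eq_iff forall_4 sum_4 B_inf_eq)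

lemma Bt_mult: "Bt y *v q = (of_real (b y) * q $ 1) *s axis 3 1"
  by (simp add: cmat_mult vec_eq_iff forall_4 sum_4 B_inf_eq B_tilde_def B_def deriv_sh_f b_def axis_def)

lemma cB_eq: "cB m n \<phi> y *v q = Binf *v q + Bt y *v q"
  by (simp add: cB_mult Binf_mult Bt_mult vec_eq_iff forall_4 axis_def deriv_sh_f b_def algebra_simps)

lemma norm_Bt_mult: "norm (Bt y *v q) = \<bar>b y\<bar> * norm (q $ 1)"
proof -
  have "norm (axis 3 1 :: complex^4) = 1"
    by (simp add: norm_vec_def L2_set_def sum_4 axis_def)
  then show ?thesis
    by (simp add: Bt_mult norm_smult_vec norm_mult)
qed

lemma abs_b_le: "\<bar>b y\<bar> \<le> K_B * exp (- C_B * \<bar>y\<bar>)"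
proof -
  have "(B m n \<phi> y - B_inf m n \<phi>) *v axis 1 1 = b y *\<^sub>R axis 3 1"
    by (simp add: vec_eq_iff forall_4 matrix_vector_mult_def sum_4 axis_def B_def B_inf_eq deriv_sh_f b_def)
  then have "norm (b y *\<^sub>R axis 3 1 :: real^4) \<le> opnorm (B m n \<phi> y - B_inf m n \<phi>) * norm (axis 1 1 :: real^4)"
    by (metis norm_matrix_vector_le)
  then show ?thesis
    using B_bound [of y] by simp
qed

lemma continuous_b: "continuous_on UNIV b"
proof -
  have "\<forall>k<4. \<forall>x. (deriv ^^ k) \<phi> differentiable (at x)"
    using pulse by (simp add: pulse_def)
  then have "\<phi> differentiable (at x)" for x
    by (auto dest: spec [of _ 0])
  then have "continuous_on UNIV \<phi>"
    by (simp add: continuous_at_imp_continuous_on differentiable_imp_continuous_within)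
  then show ?thesis
    unfolding b_def by (intro continuous_intros)
qed

lemma eigenvectors:
  "Binf *v V1s m = mu1s m *s V1s m" "Binf *v V2s m = mu2s m *s V2s m"
  "Binf *v V1u m = mu1u m *s V1u m" "Binf *v V2u m = mu2u m *s V2u m"
proof -
  let ?d = "dd m" and ?r = "complex_of_real (rho m)"
  have rd: "?r * (?d * cnj ?d) = 1"
    by (rule rho_dd_cnj [OF m_pos])
  have sq: "?r\<^sup>2 * (?d\<^sup>2 + (cnj ?d)\<^sup>2) = - 2"
    by (rule rho_dd_sq [OF m_pos])
  have m1: "1 + complex_of_real m = ?r\<^sup>2"
    by (simp add: rho_sq m_pos flip: of_real_power)
  show "Binf *v V1s m = mu1s m *s V1s m" "Binf *v V2s m = mu2s m *s V2s m"
    "Binf *v V1u m = mu1u m *s V1u m" "Binf *v V2u m = mu2u m *s V2u m"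
    unfolding Binf_mult m1 V_eq [OF m_pos] mu1s_def mu2s_def mu1u_eq [OF m_pos] mu2u_eq [OF m_pos] vec_eq_iff forall_4
    by (simp; (intro conjI)?; use rd sq in algebra)+
qed

lemma Binf_diff: "Binf - mat \<mu> = V ** dg (\<lambda>k. ev m k - \<mu>) ** G"
proof -
  have "Binf *v (V *v x) = V *v (dg (ev m) *v x)" for x
    by (simp add: Vfull_mult matrix_vector_right_distrib vector_scalar_commute eigenvectors ev_def
        vector_smult_assoc mult.commute)
  then have "Binf ** V = V ** dg (ev m)"
    by (intro matrix_vec_eqI) (simp flip: matrix_vector_mul_assoc)
  then have "Binf = V ** dg (ev m) ** G"
    using Vinv_mult [OF m_pos] by (metis matrix_mul_assoc matrix_mul_rid)
  then show ?thesis
    by (simp add: conj_dg_diff Vinv_mult m_pos)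
qed

abbreviation "\<Phi> \<mu> \<equiv> dich V G (\<lambda>k. ev m k - \<mu>) L"

lemma F_plus_eq: "F_plus Binf Bt L \<mu> v W x = v + \<Phi> \<mu> (\<lambda>y. Bt y *v W y) x"
  unfolding F_plus_def dich_def Binf_diff
  by (simp add: mexp_spectral_proj Vinv_mult m_pos)

lemma exp_decaying_Bt:
  assumes "set_borel_measurable lborel {L..} W"
    and "AE y in lborel. L \<le> y \<longrightarrow> norm (W y $ 1) \<le> R"
  shows "exp_decaying L C_B (K_B * R) (\<lambda>y. Bt y *v W y)"
  unfolding exp_decaying_def
proof
  have b: "continuous_on UNIV (\<lambda>p :: real \<times> (complex^4). b (fst p))"
    by (rule continuous_on_compose2 [OF continuous_b]) (auto intro: continuous_intros)
  have "continuous_on UNIV (\<lambda>p :: real \<times> (complex^4). Bt (fst p) *v snd p)"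
    unfolding Bt_mult vector_scalar_mult_def by (intro continuous_on_vec_lambda continuous_intros b)
  then have "(\<lambda>y. Bt y *v (indicator {L..} y *\<^sub>R W y)) \<in> borel_measurable lborel"
    using assms(1) unfolding set_borel_measurable_def
    by (intro borel_measurable_continuous_Pair [where H = "\<lambda>y w. Bt y *v w"]) simp_all
  then show "set_borel_measurable lborel {L..} (\<lambda>y. Bt y *v W y)"
    unfolding set_borel_measurable_def
    by (simp add: linear_cmul [OF bounded_linear.linear [OF matrix_vector_mul_bounded_linear]])
  show "AE y in lborel. L \<le> y \<longrightarrow> norm (Bt y *v W y) \<le> K_B * R * exp (- C_B * y)"
    using assms(2)
  proof (eventually_elim, intro impI)
    fix y assume "L \<le> y \<longrightarrow> norm (W y $ 1) \<le> R" and y: "L \<le> y"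
    then have "\<bar>b y\<bar> * norm (W y $ 1) \<le> (K_B * exp (- C_B * \<bar>y\<bar>)) * R"
      using K_B by (intro mult_mono abs_b_le) auto
    then show "norm (Bt y *v W y) \<le> K_B * R * exp (- C_B * y)"
      using y L_pos by (simp add: norm_Bt_mult mult.commute mult.left_commute)
  qed
qed

section \<open>Fixed points of the integral operator: size, differential equation,
  conjugation\<close>

lemma tau_nonneg: "0 \<le> \<tau>"
  using K_B C_B by (simp add: tau_F_def K_cond_def opnorm_nonneg)

lemma norm_Phi_le:
  assumes "exp_decaying L C_B (K_B * R) g" "L \<le> x"
  shows "norm (\<Phi> \<mu> g x) \<le> \<tau> * R"
  using norm_dich_le [OF assms(1) C_B assms(2), of V G "\<lambda>k. ev m k - \<mu>"]
  by (simp add: tau_F_def K_cond_def mult_ac)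

text \<open>The supremum \<open>R\<close> of \<open>f\<close> satisfies
  \<open>R \<le> a + \<tau> * R\<close>; the crude bound \<open>R0\<close> ensures that it exists.
  With \<open>a = 0\<close> this gives uniqueness of fixed points.\<close>

lemma contraction_bound:
  fixes f :: "real \<Rightarrow> real"
  assumes bdd: "\<And>x. L \<le> x \<Longrightarrow> f x \<le> R0"
    and step: "\<And>R x. (\<And>y. L \<le> y \<Longrightarrow> f y \<le> R) \<Longrightarrow> L \<le> x \<Longrightarrow> f x \<le> a + \<tau> * R"
    and x: "L \<le> x"
  shows "f x \<le> a / (1 - \<tau>)"
proof -
  define R where "R = (SUP y\<in>{L..}. f y)"
  have "bdd_above (f ` {L..})"
    by (rule bdd_aboveI2 [where M = R0]) (simp add: bdd)
  then have R: "f y \<le> R" if "L \<le> y" for y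
    unfolding R_def using that by (intro cSUP_upper) auto
  have "R \<le> a + \<tau> * R"
    unfolding R_def by (rule cSUP_least) (use step R in \<open>auto simp: R_def\<close>)
  then have "R \<le> a / (1 - \<tau>)"
    using tau by (simp add: field_simps)
  with R [OF x] show ?thesis
    by simp
qed

context
  fixes \<mu> :: complex and v :: "complex^4" and W :: "real \<Rightarrow> complex^4"
  assumes W: "F_plus_fixed m n \<phi> L \<mu> v W"
begin

lemma fixed_eq: "L \<le> x \<Longrightarrow> W x = v + \<Phi> \<mu> (\<lambda>y. Bt y *v W y) x"
  using W unfolding F_plus_fixed_def F_plus_eq by blast

lemma fixed_decaying: "\<exists>R. exp_decaying L C_B (K_B * R) (\<lambda>y. Bt y *v W y)"
proof -
  obtain R where R: "AE x\<in>{L..} in lborel. norm (W x) \<le> R"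
    using W by (auto simp: F_plus_fixed_def)
  have "exp_decaying L C_B (K_B * R) (\<lambda>y. Bt y *v W y)"
  proof (rule exp_decaying_Bt)
    show "set_borel_measurable lborel {L..} W"
      using W by (simp add: F_plus_fixed_def)
    show "AE y in lborel. L \<le> y \<longrightarrow> norm (W y $ 1) \<le> R"
      using R by eventually_elim (meson atLeast_iff Finite_Cartesian_Product.norm_nth_le order.trans)
  qed
  then show ?thesis ..
qed

text \<open>The essential bound becomes a bound at every point because the equation holds pointwise
  while its integral term depends only on the almost everywhere class of \<open>W\<close>.\<close>

lemma fixed_bounded: "\<exists>R. \<forall>x\<ge>L. norm (W x) \<le> R"
proof -
  obtain R where R: "exp_decaying L C_B (K_B * R) (\<lambda>y. Bt y *v W y)"
    using fixed_decaying by blast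
  have "norm (W x) \<le> norm v + \<tau> * R" if "L \<le> x" for x
    unfolding fixed_eq [OF that]
    by (rule order.trans [OF norm_triangle_ineq add_left_mono [OF norm_Phi_le [OF R that]]])
  then show ?thesis
    by blast
qed

lemma continuous_fixed: "continuous_on {L..} W"
proof -
  obtain R where R: "exp_decaying L C_B (K_B * R) (\<lambda>y. Bt y *v W y)"
    using fixed_decaying by blast
  have "continuous_on {L..} (\<lambda>x. v + \<Phi> \<mu> (\<lambda>y. Bt y *v W y) x)"
    by (intro continuous_intros continuous_dich [OF Vinv_mult [OF m_pos] R C_B])
  then show ?thesis
    by (subst continuous_on_cong [OF refl fixed_eq]) auto
qed

end

lemma exp_decaying_Bt':
  assumes "continuous_on {L..} W" and "\<And>y. L \<le> y \<Longrightarrow> norm (W y $ 1) \<le> R"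
  shows "exp_decaying L C_B (K_B * R) (\<lambda>y. Bt y *v W y)"
proof (rule exp_decaying_Bt)
  show "set_borel_measurable lborel {L..} W"
    unfolding set_borel_measurable_def
    using borel_measurable_continuous_on_indicator [OF _ assms(1)] by simp
qed (use assms(2) in auto)

text \<open>
  The perturbation \<open>Bt\<close> only sees the first component of \<open>W\<close>, so \<open>norm v\<close> can be replaced by
  \<open>norm (v $ 1)\<close>. This gain is needed below: it absorbs the factor \<open>sqrt 2\<close> lost in passing from the
  two columns to the operator norm of a two-column matrix, which must be at most \<open>\<epsilon>\<^sub>0\<close>.
\<close>

lemma norm_fixed_diff_le:
  assumes W: "F_plus_fixed m n \<phi> L \<mu> v W" and x: "L \<le> x"
  shows "norm (W x - v) \<le> \<tau> * (norm (v $ 1) / (1 - \<tau>))"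
proof -
  have diff: "norm (W x - v) \<le> \<tau> * R" if "\<And>y. L \<le> y \<Longrightarrow> norm (W y $ 1) \<le> R" "L \<le> x" for R x
    using norm_Phi_le [OF exp_decaying_Bt' [OF continuous_fixed [OF W] that(1)] that(2), of \<mu>]
    by (simp add: fixed_eq [OF W that(2)])
  obtain R0 where R0: "\<And>x. L \<le> x \<Longrightarrow> norm (W x) \<le> R0"
    using fixed_bounded [OF W] by blast
  have "norm (W x $ 1) \<le> norm (v $ 1) / (1 - \<tau>)" if "L \<le> x" for x
  proof (rule contraction_bound [OF _ _ that])
    show "norm (W x $ 1) \<le> R0" if "L \<le> x" for x
      using R0 [OF that] Finite_Cartesian_Product.norm_nth_le order.trans by blast
  next
    fix R x assume R: "\<And>y. L \<le> y \<Longrightarrow> norm (W y $ 1) \<le> R" and x: "L \<le> x"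
    have "norm (W x $ 1) \<le> norm (v $ 1) + norm ((W x - v) $ 1)"
      using norm_triangle_sub by auto
    also have "norm ((W x - v) $ 1) \<le> \<tau> * R"
      using diff [OF R x] Finite_Cartesian_Product.norm_nth_le order.trans by blast
    finally show "norm (W x $ 1) \<le> norm (v $ 1) + \<tau> * R"
      by simp
  qed
  then show ?thesis
    by (intro diff x)
qed

lemma fixed_solution:
  assumes W: "F_plus_fixed m n \<phi> L \<mu> v W" and v: "Binf *v v = \<mu> *s v" and x: "L \<le> x"
  shows "((\<lambda>x. exp (of_real x * \<mu>) *s W x) has_vector_derivative
    cB m n \<phi> x *v (exp (of_real x * \<mu>) *s W x)) (at x within {L..})"
proof -
  let ?g = "\<lambda>y. Bt y *v W y"
  obtain R where R: "exp_decaying L C_B (K_B * R) ?g"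
    using fixed_decaying [OF W] by blast
  have "continuous_on {L..} ?g"
    unfolding Bt_mult vector_scalar_mult_def
    by (intro continuous_intros continuous_fixed [OF W] continuous_on_subset [OF continuous_b]) auto
  then have "(\<Phi> \<mu> ?g has_vector_derivative ((Binf - mat \<mu>) *v \<Phi> \<mu> ?g x + ?g x)) (at x within {L..})"
    unfolding Binf_diff by (intro dich_derivative [OF Vinv_mult [OF m_pos] R C_B] x)
  \<comment> \<open>The eigenvector \<open>v\<close> is annihilated, so \<open>W\<close> may replace
    its integral part. The exponential factor afterwards cancels the shift by
    \<open>\<mu>\<close>.\<close>
  moreover have "(Binf - mat \<mu>) *v \<Phi> \<mu> ?g x = (Binf - mat \<mu>) *v W x"
    by (simp add: fixed_eq [OF W x] matrix_vector_right_distrib matrix_vector_mult_diff_rdistrib v mat_mult_vec)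
  ultimately have "((\<lambda>x. v + \<Phi> \<mu> ?g x) has_vector_derivative ((Binf - mat \<mu>) *v W x + ?g x)) (at x within {L..})"
    by (auto intro!: derivative_eq_intros)
  then have dW: "(W has_vector_derivative ((Binf - mat \<mu>) *v W x + ?g x)) (at x within {L..})"
    by (rule has_vector_derivative_transform_within [OF _ zero_less_one]) (use x fixed_eq [OF W] in auto)
  have dE: "((\<lambda>x. exp (of_real x * \<mu>)) has_vector_derivative (\<mu> * exp (of_real x * \<mu>))) (at x within {L..})"
    by (rule has_vector_derivative_real_field) (auto intro!: derivative_eq_intros)
  show ?thesis
  proof (rule has_vector_derivative_vecI)
    fix k
    have "((\<lambda>x. W x $ k) has_vector_derivative ((Binf - mat \<mu>) *v W x + ?g x) $ k) (at x within {L..})"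
      by (rule bounded_linear.has_vector_derivative [OF bounded_linear_vec_nth dW])
    from has_vector_derivative_mult [OF dE this]
    show "((\<lambda>x. (exp (of_real x * \<mu>) *s W x) $ k) has_vector_derivative
        (cB m n \<phi> x *v (exp (of_real x * \<mu>) *s W x)) $ k) (at x within {L..})"
      by (simp add: cB_eq vector_scalar_commute matrix_vector_mult_diff_rdistrib mat_mult_vec algebra_simps)
  qed
qed

lemma cnjv_Phi:
  assumes "exp_decaying L C_B c g" "L \<le> x"
  shows "cnjv (\<Phi> \<mu> g x) = \<Phi> (cnj \<mu>) (\<lambda>y. cnjv (g y)) x"
  using kern_integrable [OF assms(1) C_B assms(2), of V G "\<lambda>k. ev m k - \<mu>"]
  unfolding dich_def
  by (simp add: cnjv_algebra set_integral_bounded_linear [OF bounded_linear_cnjv] cnjv_kern m_pos)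

text \<open>Since \<open>Bt\<close> is real, the conjugate of \<open>W1\<close> solves the equation
  for \<open>cnj \<mu>\<close>. Its difference \<open>D\<close> from \<open>W2\<close> solves the
  homogeneous equation and vanishes by contraction.\<close>

lemma fixed_cnj:
  assumes W1: "F_plus_fixed m n \<phi> L \<mu> v W1" and W2: "F_plus_fixed m n \<phi> L (cnj \<mu>) (cnjv v) W2"
    and x: "L \<le> x"
  shows "W2 x = cnjv (W1 x)"
proof -
  define D where "D x = W2 x - cnjv (W1 x)" for x
  obtain R1 where R1: "exp_decaying L C_B (K_B * R1) (\<lambda>y. Bt y *v W1 y)"
    using fixed_decaying [OF W1] by blast
  obtain R2 where R2: "exp_decaying L C_B (K_B * R2) (\<lambda>y. Bt y *v W2 y)"
    using fixed_decaying [OF W2] by blast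
  have cont: "continuous_on {L..} (\<lambda>x. cnjv (W1 x))" "continuous_on {L..} D"
    unfolding D_def
    by (intro continuous_intros bounded_linear.continuous_on [OF bounded_linear_cnjv]
        continuous_fixed [OF W1] continuous_fixed [OF W2])+
  obtain R0 where R0: "\<And>x. L \<le> x \<Longrightarrow> norm (W1 x) \<le> R0"
    using fixed_bounded [OF W1] by blast
  obtain R0' where R0': "\<And>x. L \<le> x \<Longrightarrow> norm (W2 x) \<le> R0'"
    using fixed_bounded [OF W2] by blast
  have Rc: "exp_decaying L C_B (K_B * R0) (\<lambda>y. Bt y *v cnjv (W1 y))"
    by (rule exp_decaying_Bt' [OF cont(1)]) (use R0 Finite_Cartesian_Product.norm_nth_le order.trans in \<open>simp, blast\<close>)
  have D: "D x = \<Phi> (cnj \<mu>) (\<lambda>y. Bt y *v D y) x" if "L \<le> x" for x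
  proof -
    have "cnjv (Bt y *v W1 y) = Bt y *v cnjv (W1 y)" for y
      by (simp add: Bt_mult vec_eq_iff axis_def)
    then have "cnjv (W1 x) = cnjv v + \<Phi> (cnj \<mu>) (\<lambda>y. Bt y *v cnjv (W1 y)) x"
      using fixed_eq [OF W1 that] by (simp add: cnjv_algebra cnjv_Phi [OF R1 that])
    then show ?thesis
      using fixed_eq [OF W2 that] dich_diff [OF R2 Rc C_B C_B that]
      by (simp add: D_def matrix_vector_mult_diff_distrib)
  qed
  have bound: "norm (D x) \<le> \<tau> * R" if "\<And>y. L \<le> y \<Longrightarrow> norm (D y) \<le> R" "L \<le> x" for R x
  proof -
    have "exp_decaying L C_B (K_B * R) (\<lambda>y. Bt y *v D y)"
      by (rule exp_decaying_Bt' [OF cont(2)]) (use that(1) Finite_Cartesian_Product.norm_nth_le order.trans in blast)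
    then show ?thesis
      using norm_Phi_le [OF _ that(2)] D [OF that(2)] by metis
  qed
  have "norm (D x) \<le> 0 / (1 - \<tau>)"
  proof (rule contraction_bound [OF _ _ x])
    show "norm (D x) \<le> R0' + R0" if "L \<le> x" for x
      unfolding D_def using R0 [OF that] R0' [OF that]
      by (intro order.trans [OF norm_triangle_ineq4]) simp
  qed (use bound in auto)
  then show ?thesis
    by (simp add: D_def)
qed

end

section \<open>The symplectic form\<close>

text \<open>The standard symplectic form with conjugate pairs (1,3) and (2,4). It is bilinear over
  the complex numbers too, which is what makes it constant along complex solutions.\<close>

definition symp :: "'a::comm_ring_1^4 \<Rightarrow> 'a^4 \<Rightarrow> 'a" where
  "symp q p = q $ 1 * p $ 3 + q $ 2 * p $ 4 - q $ 3 * p $ 1 - q $ 4 * p $ 2"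

lemma symp_algebra:
  "symp (q + q') p = symp q p + symp q' p" "symp q (p + p') = symp q p + symp q p'"
  "symp (c *s q) p = c * symp q p" "symp q (c *s p) = c * symp q p"
  "symp q q = 0"
  by (simp_all add: symp_def algebra_simps)

lemma symp_skew: "symp p q = - symp q p"
  by (simp add: symp_def)

text \<open>The coefficient matrix is infinitesimally symplectic, so the form is constant on
  \<open>X\<close>, and the limit along \<open>F\<close> identifies the constant. Keeping
  \<open>X\<close> and \<open>F\<close> general serves both the whole line at minus infinity and
  \<open>{L..}\<close> at plus infinity.\<close>

lemma symp_solutions_eq_0:
  assumes X: "convex X" "a \<in> X" and F: "F \<noteq> bot" "\<forall>\<^sub>F x in F. x \<in> X"
    and Q: "\<And>x. x \<in> X \<Longrightarrow> (Q has_vector_derivative (cB m n \<phi> x *v Q x)) (at x within X)"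
    and P: "\<And>x. x \<in> X \<Longrightarrow> (P has_vector_derivative (cB m n \<phi> x *v P x)) (at x within X)"
    and lim: "(Q \<longlongrightarrow> 0) F" "(P \<longlongrightarrow> 0) F"
  shows "symp (Q a) (P a) = 0"
proof -
  have "((\<lambda>x. symp (Q x) (P x)) has_vector_derivative 0) (at x within X)" if "x \<in> X" for x
  proof -
    have "((\<lambda>x. Q x $ i) has_vector_derivative (cB m n \<phi> x *v Q x) $ i) (at x within X)"
      "((\<lambda>x. P x $ i) has_vector_derivative (cB m n \<phi> x *v P x) $ i) (at x within X)" for i
      by (intro bounded_linear.has_vector_derivative [OF bounded_linear_vec_nth] Q P that)+
    note [derivative_intros] = this
    show ?thesis
      unfolding symp_def
      by (rule has_vector_derivative_eq_rhs, (rule derivative_intros)+)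
        (simp add: cB_mult algebra_simps)
  qed
  from has_vector_derivative_zero_constant [OF X(1) this]
  obtain c where c: "\<And>x. x \<in> X \<Longrightarrow> symp (Q x) (P x) = c"
    by blast
  have "((\<lambda>x. symp (Q x) (P x)) \<longlongrightarrow> symp 0 0) F"
    unfolding symp_def by (intro tendsto_intros lim)
  moreover have "((\<lambda>x. symp (Q x) (P x)) \<longlongrightarrow> c) F"
    by (rule tendsto_eventually) (use F(2) c in \<open>auto elim: eventually_mono\<close>)
  ultimately have "c = symp 0 0"
    using F(1) tendsto_unique by blast
  then show ?thesis
    using c [OF X(2)] by (simp add: symp_def)
qed

text \<open>Bilinear rather than Hermitian, to match \<open>symp\<close>.\<close>

definition bdot :: "complex^2 \<Rightarrow> complex^2 \<Rightarrow> complex" where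
  "bdot x y = x $ 1 * y $ 1 + x $ 2 * y $ 2"

lemma bdot_add: "bdot (x + x') y = bdot x y + bdot x' y"
  by (simp add: bdot_def algebra_simps)

lemma norm_bdot_le: "norm (bdot x y) \<le> norm x * norm y"
proof (rule power2_le_imp_le)
  have "norm (bdot x y) \<le> norm (x $ 1) * norm (y $ 1) + norm (x $ 2) * norm (y $ 2)"
    unfolding bdot_def by (rule order.trans [OF norm_triangle_ineq]) (simp add: norm_mult)
  then have "(norm (bdot x y))\<^sup>2 \<le> (norm (x $ 1) * norm (y $ 1) + norm (x $ 2) * norm (y $ 2))\<^sup>2"
    by (rule power_mono) simp
  also have "\<dots> \<le> ((norm (x $ 1))\<^sup>2 + (norm (x $ 2))\<^sup>2) * ((norm (y $ 1))\<^sup>2 + (norm (y $ 2))\<^sup>2)"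
    using zero_le_power2 [of "norm (x $ 1) * norm (y $ 2) - norm (x $ 2) * norm (y $ 1)"]
    by (simp add: power2_eq_square algebra_simps)
  finally show "(norm (bdot x y))\<^sup>2 \<le> (norm x * norm y)\<^sup>2"
    by (simp add: power_mult_distrib norm_sq_2)
qed simp

definition pick :: "4 \<Rightarrow> 4 \<Rightarrow> complex^4 \<Rightarrow> complex^2" where
  "pick i j q = vector [q $ i, q $ j]"

lemma pick_mult: "pick i j (M *v x) = rows2 i j M *v x"
  by (simp add: pick_def rows2_mult)

lemma pick_add: "pick i j (u + v) = pick i j u + pick i j v"
  by (simp add: pick_def vec_eq_iff forall_2)

lemma norm_pick_le:
  assumes "(i, j) \<in> {(1, 2), (3, 4), (1, 4)}"
  shows "norm (pick i j q) \<le> norm q"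
  by (rule power2_le_imp_le) (use assms in \<open>auto simp: pick_def norm_sq_2 norm_sq_4\<close>)

lemma symp_pick: "symp q p = bdot (pick 1 2 q) (pick 3 4 p) - bdot (pick 3 4 q) (pick 1 2 p)"
  by (simp add: symp_def bdot_def pick_def)

text \<open>Two versions, so that the limit frame can be measured by its row blocks, as in
  \<open>C_M3\<close>, and the error by its full norm, whichever argument it occupies.\<close>

lemma norm_symp_le: "norm (symp q p) \<le> (norm (pick 3 4 q) + norm (pick 1 2 q)) * norm p"
  "norm (symp q p) \<le> (norm (pick 3 4 p) + norm (pick 1 2 p)) * norm q"
proof -
  have "norm (symp q p) \<le> norm (pick 1 2 q) * norm (pick 3 4 p) + norm (pick 3 4 q) * norm (pick 1 2 p)"
    unfolding symp_pick
    by (rule order.trans [OF norm_triangle_ineq4 add_mono [OF norm_bdot_le norm_bdot_le]])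
  moreover have "norm (pick 1 2 q) * norm (pick 3 4 p) \<le> norm (pick 1 2 q) * norm p"
    "norm (pick 3 4 q) * norm (pick 1 2 p) \<le> norm (pick 3 4 q) * norm p"
    "norm (pick 1 2 q) * norm (pick 3 4 p) \<le> norm q * norm (pick 3 4 p)"
    "norm (pick 3 4 q) * norm (pick 1 2 p) \<le> norm q * norm (pick 1 2 p)"
    by (intro mult_left_mono mult_right_mono norm_pick_le; simp)+
  ultimately show "norm (symp q p) \<le> (norm (pick 3 4 q) + norm (pick 1 2 q)) * norm p"
    "norm (symp q p) \<le> (norm (pick 3 4 p) + norm (pick 1 2 p)) * norm q"
    by (simp_all add: algebra_simps)
qed

section \<open>The matrices \<open>M\<^sub>1\<close> and \<open>M\<^sub>2\<close>\<close>

definition swap2 :: "complex^2 \<Rightarrow> complex^2" where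
  "swap2 z = vector [z $ 2, z $ 1]"

lemma norm_swap2 [simp]: "norm (swap2 z) = norm z"
  by (rule power2_eq_imp_eq) (simp_all add: norm_sq_2 swap2_def)

lemma Vs_mult: "Vs m *v x = x $ 1 *s V1s m + x $ 2 *s V2s m"
  and Vu_mult: "Vu m *v x = x $ 1 *s V1u m + x $ 2 *s V2u m"
  by (simp_all add: Vs_def Vu_def cols2_mult)

definition mat2 :: "'a::zero \<Rightarrow> 'a \<Rightarrow> 'a \<Rightarrow> 'a \<Rightarrow> 'a^2^2" where
  "mat2 a b c e = vector [vector [a, b], vector [c, e]]"

lemma mat2_nth [simp]:
  "mat2 a b c e $ 1 $ 1 = a" "mat2 a b c e $ 1 $ 2 = b" "mat2 a b c e $ 2 $ 1 = c" "mat2 a b c e $ 2 $ 2 = e"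
  by (simp_all add: mat2_def)

lemma mat2_mult_vec: "mat2 a b c e *v x = vector [a * x $ 1 + b * x $ 2, c * x $ 1 + e * x $ 2]"
  for a :: "'a::comm_ring_1"
  by (simp add: vec_eq_iff forall_2 matrix_vector_mult_def sum_2)

lemma mat2_mult: "mat2 a b c e ** mat2 a' b' c' e'
    = mat2 (a * a' + b * c') (a * b' + b * e') (c * a' + e * c') (c * b' + e * e')"
  for a :: "'a::comm_ring_1"
  by (simp add: vec_eq_iff forall_2 matrix_matrix_mult_def sum_2)

lemma mat2_uminus: "- mat2 a b c e = mat2 (- a) (- b) (- c) (- e :: 'a::comm_ring_1)"
  by (simp add: vec_eq_iff forall_2)

lemma ctranspose_mat2: "ctranspose (mat2 a b c e) = mat2 (cnj a) (cnj c) (cnj b) (cnj e)"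
  by (simp add: vec_eq_iff forall_2 ctranspose_def map_matrix_def transpose_def)

lemma rows2_cols2: "rows2 i j (cols2 u v) = mat2 (u $ i) (v $ i) (u $ j) (v $ j)"
  by (simp add: vec_eq_iff forall_2 rows2_def cols2_def transpose_def)

lemma mat2_add: "mat2 a b c e + mat2 a' b' c' e' = mat2 (a + a') (b + b') (c + c') (e + e' :: 'a::comm_ring_1)"
  by (simp add: vec_eq_iff forall_2)

section \<open>Closed forms of \<open>M1\<close> and \<open>M2\<close>, and the least
  eigenvalue\<close>

locale pos_param =
  fixes m :: real
  assumes m_pos: "0 < m"
begin

abbreviation "d \<equiv> dd m"
abbreviation "r \<equiv> complex_of_real (rho m)"

lemma d_relations:
  "r * (d * cnj d) = 1" "r\<^sup>2 * (d\<^sup>2 + (cnj d)\<^sup>2) = - 2" "r \<noteq> 0" "d \<noteq> 0" "d - cnj d \<noteq> 0"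
proof -
  show "r * (d * cnj d) = 1"
    by (rule rho_dd_cnj [OF m_pos])
  then show "r \<noteq> 0" "d \<noteq> 0"
    by auto
  show "d - cnj d \<noteq> 0"
    using dd_props(2) [OF m_pos] by (simp add: complex_eq_iff)
  show "r\<^sup>2 * (d\<^sup>2 + (cnj d)\<^sup>2) = - 2"
    by (rule rho_dd_sq [OF m_pos])
qed

lemma rows2_V:
  "rows2 1 4 (Vs m) = mat2 (d\<^sup>2) ((cnj d)\<^sup>2) (- d) (- cnj d)"
  "rows2 1 4 (Vu m) = mat2 (d\<^sup>2) ((cnj d)\<^sup>2) d (cnj d)"
  "rows2 1 2 (Vs m) = mat2 (d\<^sup>2) ((cnj d)\<^sup>2) 1 1"
  "rows2 1 2 (Vu m) = mat2 (d\<^sup>2) ((cnj d)\<^sup>2) 1 1"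
  "rows2 3 4 (Vs m) = - mat2 (r * cnj d + 2 * d) (r * d + 2 * cnj d) d (cnj d)"
  "rows2 3 4 (Vu m) = mat2 (r * cnj d + 2 * d) (r * d + 2 * cnj d) d (cnj d)"
  unfolding Vs_def Vu_def rows2_cols2
  by (simp_all add: V_eq m_pos mu1u_eq mu2u_eq vec_eq_iff forall_2)

lemma invertible_rows2_14: "invertible (rows2 1 4 (Vs m))" "invertible (rows2 1 4 (Vu m))"
proof -
  have "x = 0" if "x $ 1 * d\<^sup>2 + x $ 2 * (cnj d)\<^sup>2 = 0" "x $ 1 * d + x $ 2 * cnj d = 0" for x :: "complex^2"
  proof -
    have "x $ 1 * (d * (d - cnj d)) = 0" "x $ 2 * (cnj d * (d - cnj d)) = 0"
      using that by algebra+
    then show ?thesis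
      using d_relations by (simp add: vec_eq_iff forall_2)
  qed
  moreover have "x $ 1 * d + x $ 2 * cnj d = 0" if "- (x $ 1 * d) = x $ 2 * cnj d" for x :: "complex^2"
    using that by algebra
  ultimately show "invertible (rows2 1 4 (Vs m))" "invertible (rows2 1 4 (Vu m))"
    unfolding invertible_iff_ker rows2_V mat2_mult_vec
    by (auto simp: vec_eq_iff [of "vector _"] forall_2 mult.commute)
qed

text \<open>The columns are conjugate pairs, so a conjugate transpose is a plain transpose followed
  by the swap of the two rows. Together with the sign relations between \<open>Vs\<close> and
  \<open>Vu\<close>, this turns \<open>M1\<close> into the matrix of the bilinear form.\<close>

lemma symp_V: "- symp (Vs m *v \<xi>) (Vu m *v \<zeta>) = bdot \<xi> (swap2 (M1 m *v \<zeta>))"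
  unfolding M1_def rows2_V mat2_uminus ctranspose_mat2 mat2_mult mat2_add mat2_mult_vec Vs_mult Vu_mult
  by (simp add: symp_def bdot_def swap2_def V_eq m_pos mu1u_eq mu2u_eq algebra_simps)

text \<open>In fact \<open>w = sqrt m\<close>.\<close>

definition "w = 2 * (rho m)\<^sup>2 * Re d * - Im d"

text \<open>Since \<open>d\<close> is the reciprocal of \<open>mu1u m\<close>, this says that the
  square of that eigenvalue is \<open>- 1 + \<i> * of_real w\<close>.\<close>

lemma one_plus_d_sq: "1 + d\<^sup>2 = \<i> * of_real w * d\<^sup>2" "1 + (cnj d)\<^sup>2 = - \<i> * of_real w * (cnj d)\<^sup>2"
proof -
  note d = dd_props(3,4) [OF m_pos]
  have "(rho m)\<^sup>2 * (1 + (Re d)\<^sup>2 - (Im d)\<^sup>2) = (rho m)\<^sup>2 * (2 * w * Re d * - Im d)"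
    unfolding w_def using d by algebra
  moreover have "(rho m)\<^sup>2 \<noteq> 0"
    using rho_gt_1 [OF m_pos] by simp
  ultimately have re: "1 + (Re d)\<^sup>2 - (Im d)\<^sup>2 = 2 * w * Re d * - Im d"
    by (metis mult_left_cancel)
  have im: "2 * (Re d * Im d) = w * ((Re d)\<^sup>2 - (Im d)\<^sup>2)"
    unfolding w_def using d(2) by algebra
  show *: "1 + d\<^sup>2 = \<i> * of_real w * d\<^sup>2"
    using re im by (simp add: complex_eq_iff power2_eq_square algebra_simps)
  show "1 + (cnj d)\<^sup>2 = - \<i> * of_real w * (cnj d)\<^sup>2"
    using arg_cong [OF *, of cnj] by simp
qed

text \<open>Eigenvectors are symplectically orthogonal unless their eigenvalues sum to zero, so each
  stable one pairs only with its own unstable partner; the swap in \<open>symp_V\<close> moves these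
  pairings off the diagonal.\<close>

lemma M1_eq: "M1 m = mat2 0 (4 * \<i> * of_real w * (cnj d) ^ 3) (- 4 * \<i> * of_real w * d ^ 3) 0"
  unfolding M1_def rows2_V mat2_uminus ctranspose_mat2 mat2_mult mat2_add
  by (simp add: vec_eq_iff forall_2)
    (intro conjI; use d_relations(1,2) one_plus_d_sq in algebra)

definition "p = Re d"
definition "q = - Im d"

lemma d_pq: "d + cnj d = 2 * of_real p" "cnj d - d = 2 * \<i> * of_real q"
  by (simp_all add: p_def q_def complex_eq_iff)

lemma pq_pos: "0 < p" "0 < q" "0 < w"
  using dd_props(1,2) [OF m_pos] rho_gt_1 [OF m_pos] by (simp_all add: p_def q_def w_def mult_pos_neg)

text \<open>Checked by multiplying back. The denominator \<open>q\<close> stems from the determinant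
  of rows 1 and 4 of \<open>Vs\<close>, which contains the factor \<open>d - cnj d\<close>.\<close>

lemma M2_eq: "M2 m = mat2 (\<i> * of_real p / of_real q) (\<i> * r * (cnj d) ^ 3 / of_real q)
    (- \<i> * r * d ^ 3 / of_real q) (- \<i> * of_real p / of_real q)" (is "_ = ?X")
proof -
  have q: "complex_of_real q \<noteq> 0"
    using pq_pos by simp
  have "rows2 1 4 (Vs m) ** ?X = rows2 1 4 (Vu m)"
  proof -
    have ii: "\<i> * \<i> = (- 1 :: complex)"
      by simp
    have 1: "d\<^sup>2 * (\<i> * of_real p) - (cnj d)\<^sup>2 * (\<i> * r * d ^ 3) = of_real q * d\<^sup>2"
      using d_relations(1) d_pq ii by algebra
    have 2: "d\<^sup>2 * (\<i> * r * (cnj d) ^ 3) - (cnj d)\<^sup>2 * (\<i> * of_real p) = of_real q * (cnj d)\<^sup>2"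
      using d_relations(1) d_pq ii by algebra
    have 3: "- d * (\<i> * of_real p) + cnj d * (\<i> * r * d ^ 3) = of_real q * d"
      using d_relations(1) d_pq ii by algebra
    have 4: "- d * (\<i> * r * (cnj d) ^ 3) + cnj d * (\<i> * of_real p) = of_real q * cnj d"
      using d_relations(1) d_pq ii by algebra
    show ?thesis
      unfolding rows2_V mat2_mult
      using 1 2 3 4 q by (simp add: vec_eq_iff forall_2 divide_simps)
  qed
  then have "matrix_inv (rows2 1 4 (Vs m)) ** rows2 1 4 (Vu m)
      = matrix_inv (rows2 1 4 (Vs m)) ** rows2 1 4 (Vs m) ** ?X"
    by (simp only: matrix_mul_assoc [symmetric])
  then show ?thesis
    by (simp add: M2_def matrix_inv_mult invertible_rows2_14)
qed

text \<open>The smaller eigenvalue of the Hermitian matrix in \<open>M2_star_M1\<close>: common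
  diagonal entry minus the modulus of the off-diagonal entry.\<close>

definition "gap = 4 * w / q * (1 / (rho m)\<^sup>2 - p * cmod d ^ 3)"

lemma cmod_d: "(cmod d)\<^sup>2 = 1 / rho m"
  using dd_props(3) [OF m_pos] rho_gt_1 [OF m_pos] by (simp add: cmod_power2 field_simps)

lemma d_cnj_cube: "d ^ 3 * (cnj d) ^ 3 = of_real ((cmod d ^ 3)\<^sup>2)" "(cmod d ^ 3)\<^sup>2 = 1 / rho m ^ 3"
proof -
  have "d ^ 3 * (cnj d) ^ 3 = (d * cnj d) ^ 3"
    by (simp add: power_mult_distrib)
  also have "\<dots> = of_real (((cmod d)\<^sup>2) ^ 3)"
    by (simp only: of_real_power flip: complex_norm_square)
  finally show "d ^ 3 * (cnj d) ^ 3 = of_real ((cmod d ^ 3)\<^sup>2)"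
    by (simp add: mult.commute flip: power_mult)
  have "(cmod d ^ 3)\<^sup>2 = ((cmod d)\<^sup>2) ^ 3"
    by (simp add: mult.commute flip: power_mult)
  then show "(cmod d ^ 3)\<^sup>2 = 1 / rho m ^ 3"
    by (simp add: cmod_d power_divide)
qed

lemma gap_nonneg: "0 \<le> gap"
proof -
  have "p * cmod d ^ 3 \<le> cmod d * cmod d ^ 3"
    by (intro mult_right_mono) (auto simp: p_def complex_Re_le_cmod)
  also have "\<dots> = ((cmod d)\<^sup>2)\<^sup>2"
    by (simp add: power2_eq_square power3_eq_cube)
  also have "\<dots> = 1 / (rho m)\<^sup>2"
    by (simp add: cmod_d power_divide)
  finally show ?thesis
    unfolding gap_def using pq_pos by simp
qed

text \<open>The product is Hermitian, so the matrix in \<open>sigma_min\<close> is its square and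
  eigenvalues can be read off before squaring.\<close>

lemma M2_star_M1:
  "ctranspose (M2 m) ** M1 m = mat2 (of_real (4 * w / q / (rho m)\<^sup>2)) (of_real (4 * w * p / q) * (cnj d) ^ 3)
     (of_real (4 * w * p / q) * d ^ 3) (of_real (4 * w / q / (rho m)\<^sup>2))" (is "_ = ?A")
  and M1_star_M2: "ctranspose (M1 m) ** M2 m = ctranspose (M2 m) ** M1 m"
proof -
  have r: "r * (1 / r ^ 3) = 1 / r\<^sup>2"
    using d_relations(3) by (simp add: power2_eq_square power3_eq_cube)
  have c: "d ^ 3 * (cnj d) ^ 3 = 1 / r ^ 3"
    by (simp only: d_cnj_cube of_real_divide of_real_1 of_real_power)
  have e: "r * (cnj d) ^ 3 * d ^ 3 = 1 / r\<^sup>2" "r * d ^ 3 * (cnj d) ^ 3 = 1 / r\<^sup>2"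
    using c r by (simp_all add: ac_simps)
  show 1: "ctranspose (M2 m) ** M1 m = ?A"
    unfolding M1_eq M2_eq ctranspose_mat2 mat2_mult
    using e by (simp add: vec_eq_iff forall_2) (simp add: field_simps)
  show "ctranspose (M1 m) ** M2 m = ctranspose (M2 m) ** M1 m"
    unfolding 1 unfolding M1_eq M2_eq ctranspose_mat2 mat2_mult
    using e by (simp add: vec_eq_iff forall_2) (simp add: field_simps)
qed

lemma eigenvalue_gap: "of_real (gap\<^sup>2) \<in> eigenvalues (ctranspose (M1 m) ** M2 m ** ctranspose (M2 m) ** M1 m)"
proof -
  \<comment> \<open>The phase of the second entry is chosen so that the off-diagonal contribution is
    subtracted from the diagonal one.\<close>
  define v :: "complex^2" where "v = vector [of_real (cmod d ^ 3), - (d ^ 3)]"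
  have "v \<noteq> 0"
    using d_relations(4) by (simp add: v_def vec_eq_iff forall_2)
  have Av: "(ctranspose (M2 m) ** M1 m) *v v = of_real gap *s v"
  proof -
    define \<alpha> \<beta> k where "\<alpha> = 4 * w / q / (rho m)\<^sup>2" and "\<beta> = 4 * w * p / q" and "k = cmod d ^ 3"
    have kk: "(cnj d) ^ 3 * d ^ 3 = of_real k * of_real k"
      using d_cnj_cube(1) by (simp only: k_def power2_eq_square mult.commute of_real_mult)
    have "gap = \<alpha> - \<beta> * k"
      by (simp add: gap_def \<alpha>_def \<beta>_def k_def right_diff_distrib)
    then have g: "complex_of_real gap = of_real \<alpha> - of_real \<beta> * of_real k"
      by simp
    show ?thesis
      unfolding M2_star_M1 mat2_mult_vec v_def \<alpha>_def [symmetric] \<beta>_def [symmetric] k_def [symmetric]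
      using kk by (simp add: vec_eq_iff forall_2 g algebra_simps)
  qed
  have "(ctranspose (M1 m) ** M2 m ** ctranspose (M2 m) ** M1 m) *v v
      = (ctranspose (M1 m) ** M2 m) *v ((ctranspose (M2 m) ** M1 m) *v v)"
    by (simp add: matrix_vector_mul_assoc matrix_mul_assoc)
  also have "\<dots> = of_real (gap\<^sup>2) *s v"
    by (simp add: M1_star_M2 Av vector_scalar_commute power2_eq_square vector_smult_assoc)
  finally show ?thesis
    using \<open>v \<noteq> 0\<close> unfolding eigenvalues_def by blast
qed

lemma sigma_min_le_gap: "sigma_min m \<le> gap"
proof -
  let ?E = "eigenvalues (ctranspose (M1 m) ** M2 m ** ctranspose (M2 m) ** M1 m)"
  have fin: "finite (eigenvalues A)" for A :: "complex^2^2"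
  proof (rule finite_subset)
    \<comment> \<open>The characteristic polynomial of \<open>A\<close>; its finitely many roots
      make the set under \<open>Min\<close> finite.\<close>
    define P where "P = [:A $ 1 $ 1 * A $ 2 $ 2 - A $ 1 $ 2 * A $ 2 $ 1, - (A $ 1 $ 1 + A $ 2 $ 2), 1:]"
    show "eigenvalues A \<subseteq> {z. poly P z = 0}"
    proof
      fix z assume "z \<in> eigenvalues A"
      then obtain v where v: "v \<noteq> 0" "A *v v = z *s v"
        by (auto simp: eigenvalues_def)
      have e: "A $ 1 $ 1 * v $ 1 + A $ 1 $ 2 * v $ 2 = z * v $ 1" "A $ 2 $ 1 * v $ 1 + A $ 2 $ 2 * v $ 2 = z * v $ 2"
        using v(2) by (simp_all add: vec_eq_iff forall_2 matrix_vector_mult_def sum_2)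
      have P: "poly P z = (A $ 1 $ 1 - z) * (A $ 2 $ 2 - z) - A $ 1 $ 2 * A $ 2 $ 1"
        by (simp add: P_def algebra_simps)
      have "poly P z * v $ 1 = 0" "poly P z * v $ 2 = 0"
        using e unfolding P by algebra+
      then show "z \<in> {z. poly P z = 0}"
        using v(1) by (auto simp: vec_eq_iff forall_2)
    qed
    show "finite {z. poly P z = 0}"
      by (rule poly_roots_finite) (simp add: P_def)
  qed
  have "{sqrt (cmod z) | z. z \<in> ?E} = (\<lambda>z. sqrt (cmod z)) ` ?E"
    by auto
  moreover have "gap = sqrt (cmod (of_real (gap\<^sup>2)))"
    unfolding norm_of_real using gap_nonneg by simp
  then have "gap \<in> (\<lambda>z. sqrt (cmod z)) ` ?E"
    by (rule image_eqI) (rule eigenvalue_gap)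
  ultimately show ?thesis
    unfolding sigma_min_def using fin by (intro Min_le) simp_all
qed

text \<open>
  Restricted to vectors \<open>(z, cnj z)\<close> the bilinear form below is a Hermitian form, with matrix
  \<open>M\<^sub>2\<^sup>* M\<^sub>1\<close>, which is positive; its least eigenvalue is therefore also its least singular value.
\<close>

lemma sigma_min_le_form:
  assumes "\<zeta> $ 2 = cnj (\<zeta> $ 1)"
  shows "sigma_min m * (norm \<zeta>)\<^sup>2 \<le> norm (bdot (M2 m *v \<zeta>) (swap2 (M1 m *v \<zeta>)))"
proof -
  define z where "z = \<zeta> $ 1"
  have n: "(norm \<zeta>)\<^sup>2 = 2 * (cmod z)\<^sup>2"
    using assms by (simp add: norm_sq_2 z_def)
  define form where "form = 8 * w / q * (p * Re (d ^ 3 * z\<^sup>2) + (cmod z)\<^sup>2 / (rho m)\<^sup>2)"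
  have "cmod (d ^ 3 * z\<^sup>2) = cmod d ^ 3 * (cmod z)\<^sup>2"
    by (simp add: norm_mult norm_power)
  then have "- (cmod d ^ 3 * (cmod z)\<^sup>2) \<le> Re (d ^ 3 * z\<^sup>2)"
    using abs_Re_le_cmod [of "d ^ 3 * z\<^sup>2"] by simp
  then have "p * (- (cmod d ^ 3 * (cmod z)\<^sup>2)) \<le> p * Re (d ^ 3 * z\<^sup>2)"
    using pq_pos by (intro mult_left_mono) auto
  then have "8 * w / q * (p * (- (cmod d ^ 3 * (cmod z)\<^sup>2)) + (cmod z)\<^sup>2 / (rho m)\<^sup>2) \<le> form"
    unfolding form_def using pq_pos by (intro mult_left_mono) auto
  also have "8 * w / q * (p * (- (cmod d ^ 3 * (cmod z)\<^sup>2)) + (cmod z)\<^sup>2 / (rho m)\<^sup>2) = gap * (norm \<zeta>)\<^sup>2"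
    by (simp add: gap_def n algebra_simps)
  finally have "gap * (norm \<zeta>)\<^sup>2 \<le> form" .
  then have "sigma_min m * (norm \<zeta>)\<^sup>2 \<le> form"
    using mult_right_mono [OF sigma_min_le_gap, of "(norm \<zeta>)\<^sup>2"] by simp
  moreover have "bdot (M2 m *v \<zeta>) (swap2 (M1 m *v \<zeta>)) = of_real form"
  proof -
    have "complex_of_real (Re u) = (u + cnj u) / 2" for u
      by (simp add: complex_add_cnj)
    from this [of "d ^ 3 * z\<^sup>2"]
    have re: "complex_of_real (Re (d ^ 3 * z\<^sup>2)) = (d ^ 3 * z\<^sup>2 + (cnj d) ^ 3 * (cnj z)\<^sup>2) / 2"
      by (simp only: complex_cnj_mult complex_cnj_power)
    have zz: "complex_of_real ((cmod z)\<^sup>2) = z * cnj z"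
      by (rule complex_norm_square)
    have "r * (1 / r ^ 3) = 1 / r\<^sup>2"
      using d_relations(3) by (simp add: power2_eq_square power3_eq_cube)
    then have e: "1 / r\<^sup>2 = r * (d ^ 3 * (cnj d) ^ 3)"
      by (simp only: d_cnj_cube of_real_divide of_real_1 of_real_power)
    have "of_real form = 8 * of_real w / of_real q *
        (of_real p * ((d ^ 3 * z\<^sup>2 + (cnj d) ^ 3 * (cnj z)\<^sup>2) / 2) + z * cnj z * (1 / r\<^sup>2))"
      unfolding form_def of_real_mult of_real_add of_real_divide re zz by simp
    also have "\<dots> = 4 * of_real w / of_real q * (of_real p * (d ^ 3 * z\<^sup>2 + (cnj d) ^ 3 * (cnj z)\<^sup>2)
        + 2 * r * z * cnj z * (d ^ 3 * (cnj d) ^ 3))"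
      unfolding e by (simp add: algebra_simps)
    also have "\<dots> = bdot (M2 m *v \<zeta>) (swap2 (M1 m *v \<zeta>))"
      unfolding M1_eq M2_eq mat2_mult_vec bdot_def swap2_def assms z_def [symmetric]
      using pq_pos by (simp add: field_simps power2_eq_square)
    finally show ?thesis
      by simp
  qed
  ultimately show ?thesis
    by simp
qed

lemma opnorm_rows2_V:
  "opnorm (rows2 3 4 (Vu m)) = opnorm (rows2 3 4 (Vs m))" "opnorm (rows2 1 2 (Vu m)) = opnorm (rows2 1 2 (Vs m))"
  by (simp_all add: rows2_V opnorm_uminus)

text \<open>The first component has modulus \<open>1 / rho m\<close>, and the second, being 1, is at
  least as large.\<close>

lemma sqrt2_le_norm_V1s: "sqrt 2 / rho m \<le> norm (V1s m)"
proof (rule power2_le_imp_le)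
  have "(norm (V1s m $ 1))\<^sup>2 + (norm (V1s m $ 2))\<^sup>2 \<le> (norm (V1s m))\<^sup>2"
    by (simp add: norm_sq_4 add_nonneg_nonneg)
  moreover have "norm (V1s m $ 1) = 1 / rho m" "norm (V1s m $ 2) = 1"
    by (rule norm_V_fst [OF m_pos]) (simp add: V_eq m_pos)
  moreover have "1 / (rho m)\<^sup>2 \<le> 1"
    using rho_gt_1 [OF m_pos] by simp
  ultimately show "(sqrt 2 / rho m)\<^sup>2 \<le> (norm (V1s m))\<^sup>2"
    by (simp add: power_divide)
qed simp

end

text \<open>Solving the equation gives \<open>y\<close> as \<open>z\<close> minus the inverse of
  \<open>A\<close> applied to \<open>a\<close>. Writing the error \<open>c\<close> inside
  \<open>z\<close> as \<open>M\<close> applied to a shift of \<open>\<zeta>\<close> lets the norm of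
  the quotient factor out, which explains the shape of \<open>C_M4\<close>.\<close>

lemma perturbed_quotient:
  fixes A C :: "complex^2^2"
  assumes inv: "invertible A" "invertible C" and e: "0 \<le> e" "e * opnorm (matrix_inv A) < 1"
    and a: "norm a \<le> e * norm y" and c: "norm c \<le> e * norm \<zeta>"
    and eq: "A *v y + a = C *v \<zeta> + c"
  shows "norm (y - (matrix_inv A ** C) *v \<zeta>) \<le> e * (opnorm (matrix_inv A ** C) *
     (opnorm (matrix_inv C) + opnorm (matrix_inv A) * (1 + e * opnorm (matrix_inv C)) / (1 - e * opnorm (matrix_inv A))))
     * norm \<zeta>"
proof -
  define M where "M = matrix_inv A ** C"
  define z where "z = M *v (\<zeta> + matrix_inv C *v c)"
  let ?iA = "opnorm (matrix_inv A)" and ?iC = "opnorm (matrix_inv C)" and ?M = "opnorm M"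
  have nn: "0 \<le> ?iA" "0 \<le> ?iC" "0 \<le> ?M"
    by (rule opnorm_nonneg)+
  have ic: "norm (matrix_inv C *v c) \<le> ?iC * (e * norm \<zeta>)"
    by (rule order.trans [OF norm_matrix_vector_le mult_left_mono [OF c nn(2)]])
  have ia: "norm (matrix_inv A *v a) \<le> ?iA * (e * norm y)"
    by (rule order.trans [OF norm_matrix_vector_le mult_left_mono [OF a nn(1)]])
  have "z = matrix_inv A *v (C *v \<zeta> + c)"
    by (simp add: z_def M_def matrix_vector_right_distrib inverse_mult_vec inv flip: matrix_vector_mul_assoc)
  then have yz: "y + matrix_inv A *v a = z"
    by (simp add: matrix_vector_right_distrib inverse_mult_vec inv flip: eq)
  have zM: "norm (z - M *v \<zeta>) \<le> ?M * (?iC * (e * norm \<zeta>))"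
  proof -
    have "z - M *v \<zeta> = M *v (matrix_inv C *v c)"
      by (simp add: z_def matrix_vector_right_distrib)
    then show ?thesis
      by (metis order.trans [OF norm_matrix_vector_le mult_left_mono [OF ic nn(3)]])
  qed
  have nz: "norm z \<le> ?M * (norm \<zeta> + ?iC * (e * norm \<zeta>))"
    unfolding z_def
    by (rule order.trans [OF norm_matrix_vector_le mult_left_mono [OF _ nn(3)]])
      (rule order.trans [OF norm_triangle_ineq add_left_mono [OF ic]])
  \<comment> \<open>The error \<open>a\<close> is measured by \<open>y\<close> itself; since
    \<open>e * ?iA < 1\<close>, its contribution can be moved to the left.\<close>
  have "norm y \<le> norm z + norm (matrix_inv A *v a)"
    using norm_triangle_ineq4 [of z "matrix_inv A *v a"] by (simp flip: yz)
  then have "(1 - e * ?iA) * norm y \<le> norm z"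
    using ia by (simp add: algebra_simps)
  then have y: "norm y \<le> norm z / (1 - e * ?iA)"
    using e(2) by (simp add: field_simps)
  have "norm (y - M *v \<zeta>) \<le> norm (y - z) + norm (z - M *v \<zeta>)"
    using norm_triangle_ineq [of "y - z" "z - M *v \<zeta>"] by simp
  also have "norm (y - z) = norm (matrix_inv A *v a)"
    by (simp flip: yz)
  also have "\<dots> \<le> ?iA * (e * (norm z / (1 - e * ?iA)))"
    by (rule order.trans [OF ia]) (intro mult_left_mono y nn e)
  also have "\<dots> \<le> ?iA * (e * (?M * (norm \<zeta> + ?iC * (e * norm \<zeta>)) / (1 - e * ?iA)))"
    by (intro mult_left_mono divide_right_mono nz nn e) (use e in simp)
  also note zM
  finally have "norm (y - M *v \<zeta>) \<le> ?iA * (e * (?M * (norm \<zeta> + ?iC * (e * norm \<zeta>)) / (1 - e * ?iA)))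
    + ?M * (?iC * (e * norm \<zeta>))"
    by simp
  also have "\<dots> = e * (?M * (?iC + ?iA * (1 + e * ?iC) / (1 - e * ?iA))) * norm \<zeta>"
    using e(2) by (simp add: field_simps)
  finally show ?thesis
    unfolding M_def .
qed

section \<open>Frames close to the asymptotic ones\<close>

locale perturbed_frame = pos_param m for m :: real +
  fixes e :: real and Ws Wu :: "complex^2^4"
  assumes e_nonneg: "0 \<le> e"
    and Ws: "\<And>z. norm (Ws *v z) \<le> e * norm z"
    and Wu: "\<And>z. norm (Wu *v z) \<le> e * norm z"
    and small: "e * opnorm (matrix_inv (rows2 1 4 (Vs m))) < 1"
begin

abbreviation "S z \<equiv> (Vs m + Ws) *v z"
abbreviation "T z \<equiv> (Vu m + Wu) *v z"

lemma S_eq: "S z = Vs m *v z + Ws *v z" and T_eq: "T z = Vu m *v z + Wu *v z"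
  by (simp_all add: matrix_vector_mult_add_rdistrib)

lemma quotient_estimate:
  assumes "pick 1 4 (S y) = pick 1 4 (T \<zeta>)"
  shows "norm (y - M2 m *v \<zeta>) \<le> e * C_M4 m e * norm \<zeta>"
proof -
  have "norm (y - (matrix_inv (rows2 1 4 (Vs m)) ** rows2 1 4 (Vu m)) *v \<zeta>) \<le>
      e * (opnorm (matrix_inv (rows2 1 4 (Vs m)) ** rows2 1 4 (Vu m)) *
     (opnorm (matrix_inv (rows2 1 4 (Vu m))) + opnorm (matrix_inv (rows2 1 4 (Vs m)))
       * (1 + e * opnorm (matrix_inv (rows2 1 4 (Vu m)))) / (1 - e * opnorm (matrix_inv (rows2 1 4 (Vs m))))))
     * norm \<zeta>"
  proof (rule perturbed_quotient)
    show "norm (pick 1 4 (Ws *v y)) \<le> e * norm y" "norm (pick 1 4 (Wu *v \<zeta>)) \<le> e * norm \<zeta>"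
      by (rule order.trans [OF norm_pick_le Ws], simp, rule order.trans [OF norm_pick_le Wu], simp)
    show "rows2 1 4 (Vs m) *v y + pick 1 4 (Ws *v y) = rows2 1 4 (Vu m) *v \<zeta> + pick 1 4 (Wu *v \<zeta>)"
      using assms by (simp add: S_eq T_eq pick_add pick_mult)
  qed (use m_pos e_nonneg small in \<open>auto intro: invertible_rows2_14\<close>)
  then show ?thesis
    unfolding C_M4_def M2_def .
qed

text \<open>The quotient estimate with zero unstable part gives injectivity of a square matrix,
  hence also surjectivity below.\<close>

lemma pick_S_eq_0: "pick 1 4 (S y) = 0 \<Longrightarrow> y = 0"
  using quotient_estimate [of y 0] by (simp add: pick_def vec_eq_iff forall_2)

lemma pick_S_surj: "\<exists>z. pick 1 4 (S z) = y"
proof -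
  have "invertible (rows2 1 4 (Vs m + Ws))"
    unfolding invertible_iff_ker using pick_S_eq_0 by (simp add: pick_mult)
  then have "pick 1 4 (S (matrix_inv (rows2 1 4 (Vs m + Ws)) *v y)) = y"
    by (simp only: pick_mult inverse_mult_vec)
  then show ?thesis
    by blast
qed

text \<open>After matching components 1 and 4, the remainder \<open>v\<close> lives in components 2
  and 3. These are read off by pairing with frame vectors whose components 1 and 4 form the standard
  basis.\<close>

lemma lagrangian_complement:
  assumes lagr: "\<And>z z'. symp (S z) (S z') = 0" and u: "\<And>z. symp u (S z) = 0"
  shows "\<exists>z. u = S z"
proof -
  obtain z where z: "pick 1 4 (S z) = pick 1 4 u"
    using pick_S_surj by blast
  define v where "v = u - S z"
  have v14: "v $ 1 = 0" "v $ 4 = 0"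
    using z by (simp_all add: v_def pick_def vec_eq_iff forall_2)
  have "u = v + S z"
    by (simp add: v_def)
  then have v: "symp v (S z') = 0" for z'
    using u [of z'] by (simp add: symp_algebra lagr)
  obtain z1 z2 where "pick 1 4 (S z1) = vector [1, 0]" "pick 1 4 (S z2) = vector [0, 1]"
    using pick_S_surj by blast
  then have "v $ 3 = 0" "v $ 2 = 0"
    using v [of z1] v [of z2] v14 by (simp_all add: symp_def pick_def vec_eq_iff forall_2)
  then have "v = 0"
    using v14 by (simp add: vec_eq_iff forall_4)
  then show ?thesis
    by (auto simp: v_def)
qed

text \<open>The two mixed terms give the multiple of the row-block norms in \<open>C_M3\<close>, and
  the term with both errors gives its summand \<open>2 * e\<close>.\<close>

lemma symp_estimate:
  "norm (symp (S z) (T y) + bdot z (swap2 (M1 m *v y))) \<le> e * C_M3 m e * norm z * norm y"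
proof -
  let ?n = "opnorm (rows2 3 4 (Vs m)) + opnorm (rows2 1 2 (Vs m))"
  have Vz: "norm (pick 3 4 (Vs m *v z)) + norm (pick 1 2 (Vs m *v z)) \<le> ?n * norm z"
    unfolding pick_mult distrib_right by (intro add_mono norm_matrix_vector_le)
  have Vy: "norm (pick 3 4 (Vu m *v y)) + norm (pick 1 2 (Vu m *v y)) \<le> ?n * norm y"
    unfolding pick_mult distrib_right opnorm_rows2_V [symmetric]
    by (intro add_mono norm_matrix_vector_le)
  have n: "0 \<le> ?n"
    by (simp add: opnorm_nonneg)
  have 1: "norm (symp (Vs m *v z) (Wu *v y)) \<le> (?n * norm z) * (e * norm y)"
    by (rule order.trans [OF norm_symp_le(1)]) (intro mult_mono Vz Wu mult_nonneg_nonneg n; simp)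
  have 2: "norm (symp (Ws *v z) (Vu m *v y)) \<le> (?n * norm y) * (e * norm z)"
    by (rule order.trans [OF norm_symp_le(2)]) (intro mult_mono Vy Ws mult_nonneg_nonneg n; simp)
  have "norm (pick 3 4 (Ws *v z)) + norm (pick 1 2 (Ws *v z)) \<le> e * norm z + e * norm z"
    by (intro add_mono order.trans [OF norm_pick_le Ws]) simp_all
  then have 3: "norm (symp (Ws *v z) (Wu *v y)) \<le> (2 * (e * norm z)) * (e * norm y)"
    by (intro order.trans [OF norm_symp_le(1)] mult_mono Wu) (use e_nonneg in auto)
  have "symp (S z) (T y) + bdot z (swap2 (M1 m *v y))
      = symp (Vs m *v z) (Wu *v y) + symp (Ws *v z) (Vu m *v y) + symp (Ws *v z) (Wu *v y)"
    unfolding S_eq T_eq symp_algebra(1,2) symp_V [symmetric] by simp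
  then have "norm (symp (S z) (T y) + bdot z (swap2 (M1 m *v y)))
      \<le> norm (symp (Vs m *v z) (Wu *v y)) + norm (symp (Ws *v z) (Vu m *v y)) + norm (symp (Ws *v z) (Wu *v y))"
    by (metis norm_triangle_mono norm_triangle_ineq order_refl)
  also have "\<dots> \<le> e * C_M3 m e * norm z * norm y"
    using 1 2 3 by (simp add: C_M3_def algebra_simps)
  finally show ?thesis .
qed

lemma C_nonneg: "0 \<le> C_M3 m e" "0 \<le> C_M4 m e"
  unfolding C_M3_def C_M4_def using e_nonneg small
  by (auto intro!: add_nonneg_nonneg mult_nonneg_nonneg divide_nonneg_nonneg simp: opnorm_nonneg)

lemma real_sandwich_vector_eq_0:
  assumes conj: "\<And>z. cnjv (S z) = S (swap2 (cnjv z))" "\<And>z. cnjv (T z) = T (swap2 (cnjv z))"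
    and lagr: "\<And>z z'. symp (S z) (S z') = 0"
    and v: "v = a *s S \<xi> + b *s (S \<eta> + T \<zeta>)" "cnjv v = v" "pick 1 4 v = 0"
    and orth: "symp (S \<xi>) (T \<zeta>) = 0"
    and \<kappa>: "0 \<le> \<kappa>" "\<zeta> \<noteq> 0 \<Longrightarrow> norm \<eta> \<le> \<kappa> * norm \<zeta>"
    and sigma: "sigma_min m > e * C_M3 m e * opnorm (M2 m)
        + (e * C_M3 m e + opnorm (M1 m)) * (e * C_M4 m e + \<kappa>)"
  shows "v = 0"
proof -
  define \<xi>' \<zeta>' where "\<xi>' = a *s \<xi> + b *s \<eta>" and "\<zeta>' = b *s \<zeta>"
  have v': "v = S \<xi>' + T \<zeta>'"
    by (simp add: v(1) \<xi>'_def \<zeta>'_def matrix_vector_right_distrib vector_scalar_commute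
        vector_space_over_itself.scale_right_distrib vec.scale_right_distrib)
  have M: "0 \<le> e * C_M3 m e" "0 \<le> e * C_M4 m e" "0 \<le> opnorm (M1 m)" "0 \<le> opnorm (M2 m)"
    using C_nonneg e_nonneg by (simp_all add: opnorm_nonneg)
  have real: "\<zeta>' = swap2 (cnjv \<zeta>')"
  proof -
    define \<Delta> where "\<Delta> = \<zeta>' - swap2 (cnjv \<zeta>')"
    \<comment> \<open>\<open>\<Delta>\<close> changes sign under swapped conjugation; the factor
      \<open>\<i>\<close> makes it invariant, as \<open>sigma_min_le_form\<close> requires.\<close>
    define \<Delta>' where "\<Delta>' = \<i> *s \<Delta>"
    have "S (\<xi>' - swap2 (cnjv \<xi>')) + T \<Delta> = v - cnjv v"
      by (simp add: v' cnjv_algebra conj \<Delta>_def matrix_vector_mult_diff_distrib)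
    then have "T \<Delta> = - S (\<xi>' - swap2 (cnjv \<xi>'))"
      using v(2) by (simp add: eq_neg_iff_add_eq_0 add.commute)
    then have "T \<Delta> = S (- (\<xi>' - swap2 (cnjv \<xi>')))"
      by (simp add: matrix_vector_mult_diff_distrib)
    then have "symp (S z) (T \<Delta>) = 0" for z
      by (simp only: lagr)
    then have "symp (S z) (T \<Delta>') = 0" for z
      by (simp add: \<Delta>'_def vector_scalar_commute symp_algebra)
    then have est: "norm (bdot z (swap2 (M1 m *v \<Delta>'))) \<le> e * C_M3 m e * norm z * norm \<Delta>'" for z
      using symp_estimate [of z \<Delta>'] by simp
    have "\<Delta>' $ 2 = cnj (\<Delta>' $ 1)"
      by (simp add: \<Delta>'_def \<Delta>_def swap2_def algebra_simps)
    then have "sigma_min m * (norm \<Delta>')\<^sup>2 \<le> norm (bdot (M2 m *v \<Delta>') (swap2 (M1 m *v \<Delta>')))"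
      by (rule sigma_min_le_form)
    also note est
    also have "e * C_M3 m e * norm (M2 m *v \<Delta>') * norm \<Delta>' \<le> e * C_M3 m e * (opnorm (M2 m) * norm \<Delta>') * norm \<Delta>'"
      by (intro mult_left_mono mult_right_mono norm_matrix_vector_le M) simp
    finally have "sigma_min m * (norm \<Delta>')\<^sup>2 \<le> e * C_M3 m e * opnorm (M2 m) * (norm \<Delta>')\<^sup>2"
      by (simp add: power2_eq_square mult_ac)
    \<comment> \<open>\<open>T \<Delta>\<close> lies exactly in the range of \<open>S\<close>, so
      there is no quotient error and the first summand of the assumption suffices.\<close>
    moreover have "sigma_min m > e * C_M3 m e * opnorm (M2 m)"
      using sigma M \<kappa>(1) by (smt (verit) mult_nonneg_nonneg)
    ultimately have "norm \<Delta>' = 0"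
      by (metis mult_le_cancel_right not_le norm_ge_zero zero_less_power2 power_eq_0_iff zero_le_power2 less_le)
    then have "\<Delta> = 0"
      by (simp add: \<Delta>'_def)
    then show ?thesis
      by (simp add: \<Delta>_def)
  qed
  show ?thesis
  proof (cases "\<zeta>' = 0")
    case True
    then have "v = S \<xi>'"
      by (simp add: v')
    then have "\<xi>' = 0"
      using v(3) pick_S_eq_0 by blast
    then show ?thesis
      by (simp add: v' True)
  next
    case False
    \<comment> \<open>\<open>\<delta>\<close> is the full deviation from the limit quotient:
      \<open>M2 m *v \<zeta>' + \<delta>\<close> equals \<open>(- a) *s \<xi>\<close>, the direction
      for which \<open>orth\<close> is available.\<close>
    define y \<delta> where "y = - \<xi>'" and "\<delta> = y - M2 m *v \<zeta>' + b *s \<eta>"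
    let ?k = "e * C_M4 m e + \<kappa>" and ?f = "\<lambda>z. bdot z (swap2 (M1 m *v \<zeta>'))"
    have "pick 1 4 (S \<xi>') + pick 1 4 (T \<zeta>') = 0"
      using v(3) by (simp add: v' pick_add)
    moreover have "pick 1 4 (S y) = - pick 1 4 (S \<xi>')"
      unfolding y_def pick_mult by (simp add: vec_eq_iff matrix_vector_mult_def sum_negf)
    ultimately have "pick 1 4 (S y) = pick 1 4 (T \<zeta>')"
      by (simp add: add_eq_0_iff)
    then have y: "norm (y - M2 m *v \<zeta>') \<le> e * C_M4 m e * norm \<zeta>'"
      by (rule quotient_estimate)
    have "norm (b *s \<eta>) \<le> \<kappa> * norm \<zeta>'"
    proof -
      have "\<zeta> \<noteq> 0"
        using False by (auto simp: \<zeta>'_def)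
      then have "norm b * norm \<eta> \<le> norm b * (\<kappa> * norm \<zeta>)"
        by (intro mult_left_mono \<kappa>(2)) auto
      then show ?thesis
        by (simp add: \<zeta>'_def norm_smult_vec mult_ac)
    qed
    then have \<delta>: "norm \<delta> \<le> ?k * norm \<zeta>'"
      unfolding \<delta>_def distrib_right by (rule order.trans [OF norm_triangle_ineq add_mono [OF y]])
    have "M2 m *v \<zeta>' + \<delta> = (- a) *s \<xi>"
      by (simp add: \<delta>_def y_def \<xi>'_def vec_eq_iff)
    then have "symp (S (M2 m *v \<zeta>' + \<delta>)) (T \<zeta>') = 0"
      by (simp only: \<zeta>'_def vector_scalar_commute symp_algebra orth mult_zero_right)
    then have "norm (?f (M2 m *v \<zeta>' + \<delta>)) \<le> e * C_M3 m e * norm (M2 m *v \<zeta>' + \<delta>) * norm \<zeta>'"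
      using symp_estimate [of "M2 m *v \<zeta>' + \<delta>" \<zeta>'] by simp
    also have "\<dots> \<le> e * C_M3 m e * (opnorm (M2 m) * norm \<zeta>' + ?k * norm \<zeta>') * norm \<zeta>'"
      by (rule mult_right_mono [OF mult_left_mono [OF _ M(1)] norm_ge_zero])
        (rule order.trans [OF norm_triangle_ineq add_mono [OF norm_matrix_vector_le \<delta>]])
    finally have 1: "norm (?f (M2 m *v \<zeta>' + \<delta>)) \<le> e * C_M3 m e * (opnorm (M2 m) * norm \<zeta>' + ?k * norm \<zeta>') * norm \<zeta>'" .
    have "norm (?f \<delta>) \<le> norm \<delta> * norm (M1 m *v \<zeta>')"
      using norm_bdot_le [of \<delta> "swap2 (M1 m *v \<zeta>')"] by simp
    also have "\<dots> \<le> (?k * norm \<zeta>') * (opnorm (M1 m) * norm \<zeta>')"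
      using M \<kappa>(1) by (intro mult_mono \<delta> norm_matrix_vector_le) auto
    finally have 2: "norm (?f \<delta>) \<le> (?k * norm \<zeta>') * (opnorm (M1 m) * norm \<zeta>')" .
    have "sigma_min m * (norm \<zeta>')\<^sup>2 \<le> norm (?f (M2 m *v \<zeta>'))"
    proof (rule sigma_min_le_form)
      show "\<zeta>' $ 2 = cnj (\<zeta>' $ 1)"
        using arg_cong [OF real, of "\<lambda>z. z $ 2"] by (simp only: swap2_def vector_2 cnjv_nth)
    qed
    \<comment> \<open>Splitting off \<open>\<delta>\<close> by bilinearity makes the two bounds add
      up to the right-hand side of \<open>sigma\<close> times the squared norm.\<close>
    also have "?f (M2 m *v \<zeta>') = ?f (M2 m *v \<zeta>' + \<delta>) - ?f \<delta>"
      by (simp add: bdot_add)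
    also have "norm \<dots> \<le> e * C_M3 m e * (opnorm (M2 m) * norm \<zeta>' + ?k * norm \<zeta>') * norm \<zeta>'
        + (?k * norm \<zeta>') * (opnorm (M1 m) * norm \<zeta>')"
      by (rule order.trans [OF norm_triangle_ineq4 add_mono [OF 1 2]])
    also have "\<dots> = (e * C_M3 m e * opnorm (M2 m) + (e * C_M3 m e + opnorm (M1 m)) * ?k) * (norm \<zeta>')\<^sup>2"
      by (simp add: power2_eq_square algebra_simps)
    finally have "sigma_min m \<le> e * C_M3 m e * opnorm (M2 m) + (e * C_M3 m e + opnorm (M1 m)) * ?k"
      using False by (simp add: mult_le_cancel_right)
    then show ?thesis
      using sigma by simp
  qed
qed

end

section \<open>Absence of conjugate points\<close>

lemma mexp_diag2: "mexp (x *\<^sub>R diag2 a b) *v z = vector [exp (of_real x * a) * z $ 1, exp (of_real x * b) * z $ 2]"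
proof -
  have "x *\<^sub>R diag2 a b = dg (\<lambda>k. of_real x * vector [a, b] $ k)"
    by (simp add: vec_eq_iff forall_2 dg_def diag2_def scaleR_conv_of_real [where 'a = complex])
  moreover have "mexp (dg c) = dg (\<lambda>k. exp (c k))" for c :: "2 \<Rightarrow> complex"
    using mexp_conj_dg [of "mat 1" "mat 1" c] by simp
  ultimately have "mexp (x *\<^sub>R diag2 a b) = dg (\<lambda>k. exp (of_real x * vector [a, b] $ k))"
    by (simp only:)
  then show ?thesis
    by (simp only:) (simp add: vec_eq_iff forall_2)
qed

lemma norm_mexp_diag2:
  assumes "Re b = Re a"
  shows "norm (mexp (x *\<^sub>R diag2 a b) *v z) = exp (x * Re a) * norm z"
  by (rule power2_eq_imp_eq)
    (simp_all add: mexp_diag2 norm_sq_2 norm_mult power_mult_distrib assms distrib_left)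

lemma cmat_cvec: "cmat A *v cvec w = cvec (A *v w)"
  by (simp add: cmat_mult cvec_def vec_eq_iff) (simp add: matrix_vector_mult_def)

lemma bounded_linear_cvec: "bounded_linear cvec"
  by (rule bounded_linear_intro [where K = 1]) (simp_all add: cvec_def vec_eq_iff norm_vec_def scaleR_conv_of_real [where 'a = complex])

lemma cvec_mem_Eu_minus:
  assumes "v \<in> Eu_minus A x"
  shows "cvec v \<in> Eu_minus (\<lambda>x. cmat (A x)) x"
proof -
  obtain Q where Q: "v = Q x" "is_solution A Q" "(Q \<longlongrightarrow> 0) at_bot"
    using assms by (auto simp: Eu_minus_def)
  have "is_solution (\<lambda>x. cmat (A x)) (\<lambda>x. cvec (Q x))"
    using Q(2) unfolding is_solution_def cmat_cvec
    by (auto intro: bounded_linear.has_vector_derivative [OF bounded_linear_cvec])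
  moreover have "((\<lambda>x. cvec (Q x)) \<longlongrightarrow> cvec 0) at_bot"
    by (rule bounded_linear.tendsto [OF bounded_linear_cvec Q(3)])
  moreover have "cvec 0 = (0 :: complex^'a)"
    by (simp add: cvec_def vec_eq_iff)
  ultimately show ?thesis
    unfolding Eu_minus_def using Q(1) by auto
qed

lemma symp_Eu_minus:
  assumes "u \<in> Eu_minus (cB m n \<phi>) x" "v \<in> Eu_minus (cB m n \<phi>) x"
  shows "symp u v = 0"
proof -
  obtain Q P where "u = Q x" "v = P x" "is_solution (cB m n \<phi>) Q" "is_solution (cB m n \<phi>) P"
    "(Q \<longlongrightarrow> 0) at_bot" "(P \<longlongrightarrow> 0) at_bot"
    using assms by (auto simp: Eu_minus_def)
  then show ?thesis
    using symp_solutions_eq_0 [of UNIV x at_bot Q m n \<phi> P] by (simp add: is_solution_def)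
qed

lemma tendsto_exp_smult_0:
  fixes W :: "real \<Rightarrow> complex^'n"
  assumes W: "\<And>x. L \<le> x \<Longrightarrow> norm (W x) \<le> R" and \<mu>: "Re \<mu> < 0"
  shows "((\<lambda>x. exp (of_real x * \<mu>) *s W x) \<longlongrightarrow> 0) at_top"
proof (rule Lim_null_comparison)
  have "filterlim (\<lambda>x. Re \<mu> * x) at_bot at_top"
    by (rule filterlim_tendsto_neg_mult_at_bot [OF tendsto_const \<mu> filterlim_ident])
  then have "((\<lambda>x. exp (Re \<mu> * x) * R) \<longlongrightarrow> 0 * R) at_top"
    by (intro tendsto_intros filterlim_compose [OF exp_at_bot])
  then show "((\<lambda>x. exp (Re \<mu> * x) * R) \<longlongrightarrow> 0) at_top"
    by simp
  show "\<forall>\<^sub>F x in at_top. norm (exp (of_real x * \<mu>) *s W x) \<le> exp (Re \<mu> * x) * R"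
    using eventually_ge_at_top [of L]
    by eventually_elim (use W in \<open>simp add: norm_smult_vec mult.commute\<close>)
qed

text \<open>The gain \<open>1 / rho m\<close> in the column error pays for the factor
  \<open>sqrt 2\<close>, as the maximum in \<open>eps0\<close> is at least
  \<open>sqrt 2 / rho m\<close>.\<close>

lemma (in pulse_frame) sqrt2_column_le_eps0:
  "sqrt 2 * (\<tau> * (1 / rho m / (1 - \<tau>))) \<le> eps0 m K_B C_B L"
proof -
  have "sqrt 2 / rho m \<le> Max {norm (V1s m), norm (V2s m), norm (V1u m), norm (V2u m)}"
    using pos_param.sqrt2_le_norm_V1s [OF pos_param.intro [OF m_pos]] by (rule order.trans) (auto intro: Max_ge)
  then have "\<tau> / (1 - \<tau>) * (sqrt 2 / rho m) \<le> eps0 m K_B C_B L"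
    unfolding eps0_def using tau tau_nonneg by (intro mult_left_mono) auto
  then show ?thesis
    by (simp add: mult_ac)
qed

theorem proposition3p11:
  fixes m n K_B C_B L :: real
    and \<phi> :: "real \<Rightarrow> real"
    and W1s W2s W1u W2u U1 :: "real \<Rightarrow> complex^4"
    and \<beta> \<gamma> :: "complex^2"
  assumes m_pos: "m > 0" and n_pos: "n > 0"
    and pulse: "pulse m n \<phi>"
    and K_B: "K_B > 0" and C_B: "C_B > 0"
    and B_bound: "\<And>x. opnorm (B m n \<phi> x - B_inf m n \<phi>) \<le> K_B * exp (- C_B * \<bar>x\<bar>)"
    and simple: "\<And>x. Eu_minus (cB m n \<phi>) x \<inter> Es_plus (cB m n \<phi>) x = vec.span {cvec (U_phi' \<phi> x)}"
    and U1_sol: "is_solution (cB m n \<phi>) U1"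
    and U1_span: "\<And>x. Eu_minus (cB m n \<phi>) x = vec.span {cvec (U_phi' \<phi> x), U1 x}"
    and L_pos: "L > 0"
    and tau: "tau_F m K_B C_B L < 1"
    and W1s: "F_plus_fixed m n \<phi> L (mu1s m) (V1s m) W1s"
    and W2s: "F_plus_fixed m n \<phi> L (mu2s m) (V2s m) W2s"
    and W1u: "F_plus_fixed m n \<phi> L (mu1u m) (V1u m) W1u"
    and W2u: "F_plus_fixed m n \<phi> L (mu2u m) (V2u m) W2u"
    and U1_coords: "\<And>x. x \<ge> L \<Longrightarrow> U1 x =
          (Vs m + cols2 (W1s x - V1s m) (W2s x - V2s m)) *v (mexp (x *\<^sub>R Omega_s m) *v \<beta>)
        + (Vu m + cols2 (W1u x - V1u m) (W2u x - V2u m)) *v (mexp (x *\<^sub>R Omega_u m) *v \<gamma>)"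
    and small: "eps0 m K_B C_B L * opnorm (matrix_inv (rows2 1 4 (Vs m))) < 1"
    and sigma: "sigma_min m >
          eps0 m K_B C_B L * C_M3 m (eps0 m K_B C_B L) * opnorm (M2 m)
        + (eps0 m K_B C_B L * C_M3 m (eps0 m K_B C_B L) + opnorm (M1 m))
          * (eps0 m K_B C_B L * C_M4 m (eps0 m K_B C_B L) + eps_beta m L \<beta> * eps_gamma m L \<gamma>)"
  shows "\<forall>x\<ge>L. \<not> conjugate_point (B m n \<phi>) x \<and> Eu_minus (B m n \<phi>) x \<inter> sandwich = {0}"
proof -
  interpret pulse_frame m n \<phi> K_B C_B L
    using m_pos pulse K_B C_B B_bound L_pos tau by unfold_locales
  let ?e = "eps0 m K_B C_B L"
  have e_nonneg: "0 \<le> ?e"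
    by (rule order.trans [OF _ sqrt2_column_le_eps0]) (use tau tau_nonneg rho_gt_1 [OF m_pos] in simp)
  have zero: "v = 0" if x: "L \<le> x" and v: "v \<in> Eu_minus (B m n \<phi>) x" "v \<in> sandwich" for x v
  proof -
    define Ws where "Ws = cols2 (W1s x - V1s m) (W2s x - V2s m)"
    define Wu where "Wu = cols2 (W1u x - V1u m) (W2u x - V2u m)"
    have col: "norm (cols2 (f - a) (g - b) *v z) \<le> ?e * norm z"
      if "norm (f - a) \<le> \<tau> * (norm (a $ 1) / (1 - \<tau>))" "norm (a $ 1) = 1 / rho m"
        "norm (g - b) \<le> \<tau> * (norm (b $ 1) / (1 - \<tau>))" "norm (b $ 1) = 1 / rho m"
      for f a g b :: "complex^4" and z
    proof -
      have "norm (cols2 (f - a) (g - b) *v z) \<le> sqrt 2 * (\<tau> * (1 / rho m / (1 - \<tau>))) * norm z"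
        by (rule norm_cols2_le) (use that in auto)
      also have "\<dots> \<le> ?e * norm z"
        by (intro mult_right_mono sqrt2_column_le_eps0) simp
      finally show ?thesis .
    qed
    interpret fr: perturbed_frame m ?e Ws Wu
    proof
      show "norm (Ws *v z) \<le> ?e * norm z" for z
        unfolding Ws_def
        by (intro col norm_fixed_diff_le [OF W1s x] norm_fixed_diff_le [OF W2s x] norm_V_fst m_pos)
      show "norm (Wu *v z) \<le> ?e * norm z" for z
        unfolding Wu_def
        by (intro col norm_fixed_diff_le [OF W1u x] norm_fixed_diff_le [OF W2u x] norm_V_fst m_pos)
    qed (use m_pos e_nonneg small in auto)
    have S: "(Vs m + Ws) *v z = z $ 1 *s W1s x + z $ 2 *s W2s x" for z
      by (simp add: fr.S_eq Ws_def Vs_mult cols2_mult vec_eq_iff algebra_simps)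
    have T: "(Vu m + Wu) *v z = z $ 1 *s W1u x + z $ 2 *s W2u x" for z
      by (simp add: fr.T_eq Wu_def Vu_mult cols2_mult vec_eq_iff algebra_simps)
    have conj: "W2s x = cnjv (W1s x)" "W2u x = cnjv (W1u x)"
      using fixed_cnj [OF W1s _ x] fixed_cnj [OF W1u _ x] W2s W2u by (simp_all add: cnj_mu V2_cnjv)
    have Re_neg: "Re (mu1s m) < 0" "Re (mu2s m) < 0"
      using Re_mu [OF m_pos] by (simp_all add: mu1s_def mu2s_def)
    \<comment> \<open>The columns of the stable frame are decaying solutions divided by nonzero
      exponentials, so by bilinearity any vanishing of \<open>symp\<close> passes from the solutions
      to the columns.\<close>
    define E1 E2 where "E1 y = exp (of_real y * mu1s m) *s W1s y"
      and "E2 y = exp (of_real y * mu2s m) *s W2s y" for y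
    obtain R1 R2 where "\<And>y. L \<le> y \<Longrightarrow> norm (W1s y) \<le> R1" "\<And>y. L \<le> y \<Longrightarrow> norm (W2s y) \<le> R2"
      using fixed_bounded [OF W1s] fixed_bounded [OF W2s] by blast
    then have decay: "(E1 \<longlongrightarrow> 0) at_top" "(E2 \<longlongrightarrow> 0) at_top"
      unfolding E1_def E2_def using Re_neg by (blast intro: tendsto_exp_smult_0)+
    have E: "(E1 has_vector_derivative cB m n \<phi> y *v E1 y) (at y within {L..})"
      "(E2 has_vector_derivative cB m n \<phi> y *v E2 y) (at y within {L..})" if "y \<in> {L..}" for y
      unfolding E1_def E2_def
      by (rule fixed_solution [OF W1s eigenvectors(1)] fixed_solution [OF W2s eigenvectors(2)]; use that in simp)+
    have at_top: "convex {L..}" "x \<in> {L..}" "at_top \<noteq> (bot :: real filter)" "\<forall>\<^sub>F y in at_top. y \<in> {L..}"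
      using x by (auto simp: eventually_ge_at_top)
    have "symp (E1 x) (E2 x) = 0"
      by (rule symp_solutions_eq_0 [OF at_top E decay])
    then have W12: "symp (W1s x) (W2s x) = 0"
      by (simp add: symp_algebra E1_def E2_def)
    then have lagr: "symp ((Vs m + Ws) *v z) ((Vs m + Ws) *v z') = 0" for z z'
      using symp_skew [of "W2s x" "W1s x"] by (simp add: S symp_algebra)
    define u where "u = cvec (U_phi' \<phi> x)"
    have "u \<in> Eu_minus (cB m n \<phi>) x \<inter> Es_plus (cB m n \<phi>) x"
      unfolding simple u_def by (rule vec.span_base) simp
    then have u: "u \<in> Eu_minus (cB m n \<phi>) x" "u \<in> Es_plus (cB m n \<phi>) x"
      by auto
    obtain Q where Q: "u = Q x" "is_solution (cB m n \<phi>) Q" "(Q \<longlongrightarrow> 0) at_top"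
      using u(2) by (auto simp: Es_plus_def)
    have Q': "(Q has_vector_derivative cB m n \<phi> x *v Q x) (at x within {L..})" for x
      using Q(2) has_vector_derivative_at_within unfolding is_solution_def by blast
    have "symp (Q x) (E1 x) = 0"
      by (rule symp_solutions_eq_0 [OF at_top Q' E(1) Q(3) decay(1)])
    moreover have "symp (Q x) (E2 x) = 0"
      by (rule symp_solutions_eq_0 [OF at_top Q' E(2) Q(3) decay(2)])
    ultimately have "symp u (W1s x) = 0" "symp u (W2s x) = 0"
      by (simp_all add: symp_algebra E1_def E2_def Q(1) [symmetric])
    then have "symp u ((Vs m + Ws) *v z) = 0" for z
      by (simp add: S symp_algebra)
    then obtain \<xi> where \<xi>: "u = (Vs m + Ws) *v \<xi>"
      using fr.lagrangian_complement [OF lagr] by blast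
    define \<eta> where "\<eta> = mexp (x *\<^sub>R Omega_s m) *v \<beta>"
    define \<zeta> where "\<zeta> = mexp (x *\<^sub>R Omega_u m) *v \<gamma>"
    have U1: "U1 x = (Vs m + Ws) *v \<eta> + (Vu m + Wu) *v \<zeta>"
      using U1_coords [OF x] by (simp only: Ws_def Wu_def \<eta>_def \<zeta>_def)
    have "U1 x \<in> Eu_minus (cB m n \<phi>) x"
      unfolding U1_span by (rule vec.span_base) simp
    then have "symp u (U1 x) = 0"
      by (rule symp_Eu_minus [OF u(1)])
    then have orth: "symp ((Vs m + Ws) *v \<xi>) ((Vu m + Wu) *v \<zeta>) = 0"
      unfolding U1 \<xi> symp_algebra(2) lagr by simp
    have "cvec v \<in> vec.span {u, U1 x}"
      using cvec_mem_Eu_minus [OF v(1)] U1_span [of x] by (simp add: u_def)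
    then obtain a b where ab: "cvec v = a *s u + b *s U1 x"
      by (auto simp: vec.span_breakdown_eq vec.span_singleton algebra_simps)
    let ?\<rho> = "Re (mu1u m)"
    have \<eta>: "norm \<eta> = exp (- (x * ?\<rho>)) * norm \<beta>"
      unfolding \<eta>_def Omega_s_def
      by (subst norm_mexp_diag2) (simp_all add: mu1s_def mu2s_def Re_mu m_pos)
    have "Omega_u m = diag2 (mu1u m) (mu2u m)"
      by (simp add: Omega_u_def Omega_s_def mu1s_def mu2s_def diag2_def vec_eq_iff forall_2)
    then have \<zeta>: "norm \<zeta> = exp (x * ?\<rho>) * norm \<gamma>"
      by (simp add: \<zeta>_def norm_mexp_diag2 Re_mu m_pos)
    have "cvec v = 0"
    proof (rule fr.real_sandwich_vector_eq_0 [OF _ _ lagr])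
      show "cnjv ((Vs m + Ws) *v z) = (Vs m + Ws) *v swap2 (cnjv z)"
        "cnjv ((Vu m + Wu) *v z) = (Vu m + Wu) *v swap2 (cnjv z)" for z
        by (simp_all add: S T conj cnjv_algebra swap2_def)
      show "cvec v = a *s ((Vs m + Ws) *v \<xi>) + b *s ((Vs m + Ws) *v \<eta> + (Vu m + Wu) *v \<zeta>)"
        by (simp only: ab \<xi> U1)
      show "cnjv (cvec v) = cvec v"
        by (simp add: cvec_def vec_eq_iff)
      show "pick 1 4 (cvec v) = 0"
        using v(2) by (auto simp: sandwich_def cvec_def pick_def vec_eq_iff forall_2)
      show "symp ((Vs m + Ws) *v \<xi>) ((Vu m + Wu) *v \<zeta>) = 0"
        by (rule orth)
      show "0 \<le> eps_beta m L \<beta> * eps_gamma m L \<gamma>"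
        by (simp add: eps_beta_def eps_gamma_def)
      \<comment> \<open>The condition \<open>\<zeta> \<noteq> 0\<close> rules out
        \<open>\<gamma> = 0\<close>, where \<open>inverse 0 = 0\<close> would make the right-hand
        side vanish.\<close>
      show "norm \<eta> \<le> eps_beta m L \<beta> * eps_gamma m L \<gamma> * norm \<zeta>" if "\<zeta> \<noteq> 0"
      proof -
        have "norm \<gamma> \<noteq> 0"
          using that \<zeta> by auto
        then have "eps_beta m L \<beta> * eps_gamma m L \<gamma> * norm \<zeta> = exp (- ?\<rho> * L) * exp (- ?\<rho> * L) * exp (x * ?\<rho>) * norm \<beta>"
          by (simp add: eps_beta_def eps_gamma_def \<zeta>)
        \<comment> \<open>Relative to the factor in \<open>norm \<eta>\<close>, the excess exponent
          is \<open>2 * ((x - L) * ?\<rho>)\<close>, nonnegative because \<open>x\<close> is at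
          least \<open>L\<close>.\<close>
        also have "exp (- ?\<rho> * L) * exp (- ?\<rho> * L) * exp (x * ?\<rho>) = exp (- (x * ?\<rho>) + 2 * ((x - L) * ?\<rho>))"
          by (simp add: algebra_simps flip: exp_add)
        finally show ?thesis
          unfolding \<eta> using x Re_mu(1) [OF m_pos] by (simp add: mult_right_mono)
      qed
    qed (rule sigma)
    then show "v = 0"
      by (simp add: cvec_def vec_eq_iff)
  qed
  have "0 \<in> Eu_minus (B m n \<phi>) x" "0 \<in> sandwich" for x
  proof -
    have "is_solution (B m n \<phi>) (\<lambda>_. 0)"
      by (simp add: is_solution_def)
    then show "0 \<in> Eu_minus (B m n \<phi>) x"
      unfolding Eu_minus_def by (auto intro!: exI [of _ "\<lambda>_. 0"])
    have "(0 :: real^4) = vector [0, 0, 0, 0]"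
      by (simp add: vec_eq_iff forall_4)
    then show "0 \<in> sandwich"
      unfolding sandwich_def by blast
  qed
  then have "Eu_minus (B m n \<phi>) x \<inter> sandwich = {0}" if "L \<le> x" for x
    using zero [OF that] by auto
  then show ?thesis
    by (simp add: conjugate_point_def)
qed

end
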